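(* Let $n\ge 3$, $2\le\Delta\le n-1$ and $-1\le\alpha<0$. For every connected unicyclic graph $G$ with $n$ vertices and maximum degree $\Delta$, \[\chi_\alpha(G)\le\begin{cases}(n-\Delta-1)3^\alpha+(n-\Delta+1)(\Delta+2)^\alpha+(2\Delta-n-1)(\Delta+1)^\alpha+4^\alpha & \text{if } \frac{n+2}{2}\le\Delta\le n-1,\\ (\Delta-2)3^\alpha+\Delta(\Delta+2)^\alpha+(n-2\Delta+2)4^\alpha & \text{if } 2\le\Delta\le\frac{n+1}{2}.\end{cases}\] For $\frac{n+2}{2}\le\Delta\le n-1$ equality holds if and only if $G=U_{n,\Delta}$. For $2\le\Delta\le\frac{n+1}{2}$ equality holds if and only if $G$ is obtained from a cycle by attaching $\Delta-2$ paths, each having at least two vertices, to one fixed vertex of the cycle.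
   Context: All graphs are finite and simple; $d(v)$ denotes the degree of $v$. A unicyclic graph is a connected graph with exactly one cycle (equivalently, $n$ vertices and $n$ edges). The general sum-connectivity index is $\chi_\alpha(G)=\sum_{uv\in E(G)}(d(u)+d(v))^\alpha$. Attaching a path $P_r$ (path on $r$ vertices) to a vertex $v$ means adding a disjoint copy of $P_r$ and an edge between $v$ and a terminal vertex of the path. For $\frac{n+2}{2}\le\Delta\le n-1$, $U_{n,\Delta}$ is the unicyclic graph obtained from a triangle by attaching $2\Delta-n-1$ pendant vertices and $n-\Delta-1$ copies of $P_2$ all to the same vertex of the triangle; it has $n$ vertices and maximum degree $\Delta$. *)

theory Defs
  imports Complex_Main
begin

definition simple_graph :: "'a set \<Rightarrow> 'a set set \<Rightarrow> bool" where
  "simple_graph V E \<longleftrightarrow> finite V \<and>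
     (\<forall>e\<in>E. \<exists>u v. u \<in> V \<and> v \<in> V \<and> u \<noteq> v \<and> e = {u, v})"

definition degree :: "'a set set \<Rightarrow> 'a \<Rightarrow> nat" where
  "degree E v = card {e \<in> E. v \<in> e}"

definition max_degree :: "'a set \<Rightarrow> 'a set set \<Rightarrow> nat" where
  "max_degree V E = Max (degree E ` V)"

definition adj :: "'a set set \<Rightarrow> 'a \<Rightarrow> 'a \<Rightarrow> bool" where
  "adj E u v \<longleftrightarrow> {u, v} \<in> E \<and> u \<noteq> v"

definition connected_graph :: "'a set \<Rightarrow> 'a set set \<Rightarrow> bool" where
  "connected_graph V E \<longleftrightarrow> V \<noteq> {} \<and> (\<forall>u\<in>V. \<forall>v\<in>V. (adj E)\<^sup>*\<^sup>* u v)"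

definition unicyclic :: "'a set \<Rightarrow> 'a set set \<Rightarrow> bool" where
  "unicyclic V E \<longleftrightarrow> simple_graph V E \<and> connected_graph V E \<and> card E = card V"

definition chi :: "real \<Rightarrow> 'a set set \<Rightarrow> real" where
  "chi \<alpha> E = (\<Sum>e\<in>E. (real (\<Sum>v\<in>e. degree E v)) powr \<alpha>)"

definition graph_iso :: "'a set \<Rightarrow> 'a set set \<Rightarrow> 'b set \<Rightarrow> 'b set set \<Rightarrow> bool" where
  "graph_iso V E V' E' \<longleftrightarrow> (\<exists>f. bij_betw f V V' \<and>
      (\<forall>u\<in>V. \<forall>v\<in>V. ({u, v} \<in> E \<longleftrightarrow> {f u, f v} \<in> E')))"

text \<open>Cycle C_k on vertices 0..k-1, with paths on rs!0, rs!1, ... vertices attached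
  (by an end vertex) to vertex 0 of the cycle.  Path j occupies the vertices
  k + sum(take j rs), ..., k + sum(take j rs) + rs!j - 1.\<close>
definition cyc_paths_V :: "nat \<Rightarrow> nat list \<Rightarrow> nat set" where
  "cyc_paths_V k rs = {0..<k + sum_list rs}"

definition cyc_paths_E :: "nat \<Rightarrow> nat list \<Rightarrow> nat set set" where
  "cyc_paths_E k rs =
     {{i, (i + 1) mod k} | i. i < k}
   \<union> {{0, k + sum_list (take j rs)} | j. j < length rs}
   \<union> {{k + sum_list (take j rs) + t, k + sum_list (take j rs) + t + 1} | j t.
         j < length rs \<and> t + 1 < rs ! j}"

definition U_rs :: "nat \<Rightarrow> nat \<Rightarrow> nat list" where
  "U_rs n \<Delta> = replicate (2 * \<Delta> - n - 1) 1 @ replicate (n - \<Delta> - 1) 2"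

definition U_V :: "nat \<Rightarrow> nat \<Rightarrow> nat set" where
  "U_V n \<Delta> = cyc_paths_V 3 (U_rs n \<Delta>)"

definition U_E :: "nat \<Rightarrow> nat \<Rightarrow> nat set set" where
  "U_E n \<Delta> = cyc_paths_E 3 (U_rs n \<Delta>)"

end

theory Submission
  imports Defs "HOL-Analysis.Convex"
begin

text \<open>Fix a vertex $v$ of maximum degree $\Delta$ and split the index locally. An edge $xy$ missing $v$
  costs at most $\phi(d(x)) + \phi(d(y))$ with $\phi(d) = (2d)^\alpha/2$ for $d \<ge> 2$, by midpoint
  convexity. The cost collected at a vertex $w \<noteq> v$ is then at most an affine function of $d(w) - 2$, with a
  correction if $w$ is adjacent to $v$, and strictly less if $d(w) \<ge> 3$; here $\alpha \<ge> -1$ enters.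
  Since the degrees have average $2$, summation gives the second bound, lowered by a positive amount for
  every leaf adjacent to $v$ (if $\Delta \<ge> 3$), with equality exactly when all vertices other than $v$
  have degree at most $2$. At most one edge joins two neighbours of $v$, so there are at least
  $2\Delta - n - 1$ such leaves, which gives the first bound. Graphs with all degrees off $v$ at most $2$
  are recognised by stripping leaves down to a cycle.\<close>

section \<open>Inequalities for negative powers\<close>

text \<open>The weights are dictated by tightness. In an extremal graph every edge off $v$ joins
  degrees 1 and 2 or degrees 2 and 2. Midpoint convexity is exact for the latter but overcharges the
  former, so the weight of a leaf must lie strictly below $2^\<alpha>/2$. The price is that an edge
  between two leaves would break the estimate; connectedness rules such edges out. What remains is
  to see that the affine majorant, fixed by degrees 1 and 2, still dominates from degree 3 on. The
  inequality behind this becomes an equality at $\<alpha> = -1$, $d = 3$, so strictness has to come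
  from terms left over beside it. Both bounds are values of one expression $T - pL$, where $p$
  counts the leaves adjacent to $v$ and $L \<ge> 0$ is the loss for each: the second is its value at
  $p = 0$, the first at $p = 2\<Delta> - n - 1$. Equality in the first case therefore adds only a
  condition on $p$, from which the triangle and the branch lengths follow by counting
  vertices.\<close>

lemma powr_neg_midpoint:
  fixes a s t :: real
  assumes "a < 0" "0 < s" "0 < t"
  shows "((s + t) / 2) powr a \<le> (s powr a + t powr a) / 2"
proof -
  \<comment> \<open>AM-GM twice: for \<open>s\<close> and \<open>t\<close> under the decreasing
    power \<open>a / 2\<close>, then for the numbers \<open>s powr (a / 2)\<close> and
    \<open>t powr (a / 2)\<close>.\<close>
  have "((s + t) / 2) powr a = (((s + t) / 2)\<^sup>2) powr (a / 2)"
    using assms by (simp add: powr_powr flip: powr_numeral)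
  also have "\<dots> \<le> (s * t) powr (a / 2)"
  proof (rule powr_mono2')
    have "((s + t) / 2)\<^sup>2 - s * t = ((s - t) / 2)\<^sup>2"
      by (simp add: power2_eq_square field_simps)
    then show "s * t \<le> ((s + t) / 2)\<^sup>2"
      by (metis diff_ge_0_iff_ge zero_le_power2)
  qed (use assms in auto)
  also have "\<dots> = s powr (a / 2) * t powr (a / 2)"
    using assms by (simp add: powr_mult)
  also have "\<dots> \<le> ((s powr (a / 2))\<^sup>2 + (t powr (a / 2))\<^sup>2) / 2"
    using sum_squares_bound[of "s powr (a / 2)" "t powr (a / 2)"] by simp
  also have "\<dots> = (s powr a + t powr a) / 2"
    using assms by (simp add: powr_powr flip: powr_numeral)
  finally show ?thesis .
qed

text \<open>By convexity the unit drops of a negative power shrink. The strict form makes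
  \<open>leaf_loss\<close> positive; the weak form below handles edges at leaves.\<close>

lemma powr_neg_drop_strict:
  fixes a s t :: real
  assumes "a < 0" "0 < s" "s < t"
  shows "t powr a - (t + 1) powr a < s powr a - (s + 1) powr a"
proof (rule DERIV_neg_imp_decreasing[OF \<open>s < t\<close>])
  fix x assume x: "s \<le> x" "x \<le> t"
  have "((\<lambda>x. x powr a - (x + 1) powr a) has_real_derivative
      a * x powr (a - 1) - a * (x + 1) powr (a - 1)) (at x)"
    using x assms by (auto intro!: derivative_eq_intros)
  moreover have "(x + 1) powr (a - 1) < x powr (a - 1)"
    using x assms by (intro powr_less_mono2_neg) auto
  then have "a * x powr (a - 1) - a * (x + 1) powr (a - 1) < 0"
    using \<open>a < 0\<close> by simp
  ultimately show "\<exists>y. DERIV (\<lambda>x. x powr a - (x + 1) powr a) x :> y \<and> y < 0"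
    by blast
qed

lemma powr_neg_drop:
  fixes a s t :: real
  assumes "a < 0" "0 < s" "s \<le> t"
  shows "t powr a - (t + 1) powr a \<le> s powr a - (s + 1) powr a"
  using powr_neg_drop_strict[OF assms(1,2), of t] assms(3) by (cases "s = t") auto

text \<open>Weighted AM-GM for \<open>1 / x\<close> and \<open>1\<close> with weights
  \<open>- a\<close> and \<open>1 + a\<close>, which are nonnegative because \<open>a\<close> lies
  between -1 and 0. The bound is affine in \<open>a\<close> and exact at both ends of that
  interval.\<close>

lemma powr_neg_Bernoulli:
  fixes a x :: real
  assumes "-1 \<le> a" "a \<le> 0" "0 < x"
  shows "x powr a \<le> 1 - a * (1 / x - 1)"
proof -
  have "(1 / x) powr (- a) * 1 powr (1 + a) \<le> (- a) * (1 / x) + (1 + a) * 1"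
    by (rule Youngs_inequality_0) (use assms in auto)
  then show ?thesis
    using assms by (simp add: powr_divide powr_minus field_simps)
qed

text \<open>After division by $4^a$ this is linear in $a$ up to Bernoulli's inequality, and the
  endpoint $a = -1$ is $2(d-1)/d + 8(d-2)/3 \<le> 3d-5$, that is $(d-2)(d-3) \<ge> 0$.\<close>
lemma branch_vertex_cost:
  fixes a :: real and d :: nat
  assumes "-1 \<le> a" "a < 0" "3 \<le> d"
  shows "(real d - 2) * (3 powr a - 4 powr a) \<le> (real d - 1) * (4 powr a - (2 * real d) powr a) / 2"
proof -
  have d: "(2 * real d) powr a = 4 powr a * (real d / 2) powr a"
    using assms by (simp flip: powr_mult)
  have t: "(3::real) powr a = 4 powr a * (3 / 4) powr a"
    by (simp flip: powr_mult)
  have "(real d - 1) * (real d / 2) powr a + 2 * (real d - 2) * (3 / 4) powr a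
      \<le> (real d - 1) * (1 - a * (2 / real d - 1)) + 2 * (real d - 2) * (1 - a * (4 / 3 - 1))"
    using powr_neg_Bernoulli[of a "real d / 2"] powr_neg_Bernoulli[of a "3 / 4"] assms
    by (intro add_mono mult_left_mono) auto
  also have "\<dots> = (3 * real d - 5) + a * ((real d - 2) * (real d - 3)) / (3 * real d)"
    using assms by (simp add: field_simps)
  also have "\<dots> \<le> 3 * real d - 5"
    using assms by (simp add: divide_nonpos_nonneg mult_nonpos_nonneg)
  finally have "4 powr a * ((real d - 1) * (real d / 2) powr a + 2 * (real d - 2) * (3 / 4) powr a)
      \<le> 4 powr a * (3 * real d - 5)"
    by (intro mult_left_mono) auto
  then show ?thesis
    unfolding d t by (simp add: algebra_simps)
qed

section \<open>Connected simple graphs\<close>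

definition nbrs :: "'a set set \<Rightarrow> 'a \<Rightarrow> 'a set" where
  "nbrs E v = {w. {v, w} \<in> E}"

lemma nbrs_commute: "w \<in> nbrs E v \<longleftrightarrow> v \<in> nbrs E w"
  by (simp add: nbrs_def insert_commute)

lemma simple_graph_edgeE:
  assumes "simple_graph V E" "e \<in> E"
  obtains x y where "x \<in> V" "y \<in> V" "x \<noteq> y" "e = {x, y}"
  using assms unfolding simple_graph_def by blast

lemma simple_graph_edge_at:
  assumes "simple_graph V E" "e \<in> E" "x \<in> e"
  obtains y where "x \<in> V" "y \<in> V" "x \<noteq> y" "e = {x, y}"
  by (rule simple_graph_edgeE[OF assms(1,2)]) (use assms(3) that in \<open>auto simp: insert_commute\<close>)

lemma simple_graph_finite_edges: "simple_graph V E \<Longrightarrow> finite E"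
  by (rule finite_subset[of _ "Pow V"]) (auto simp: simple_graph_def)

lemma simple_graph_edge_card: "simple_graph V E \<Longrightarrow> e \<in> E \<Longrightarrow> card e = 2"
  by (auto elim: simple_graph_edgeE)

lemma simple_graph_nbrs:
  assumes "simple_graph V E" "w \<in> nbrs E v"
  shows "v \<in> V" "w \<in> V" "v \<noteq> w"
  using assms by (auto simp: nbrs_def doubleton_eq_iff elim!: simple_graph_edgeE)

lemma simple_graph_finite_nbrs: "simple_graph V E \<Longrightarrow> finite (nbrs E v)"
  by (rule finite_subset[of _ V]) (auto simp: simple_graph_def dest: simple_graph_nbrs[rotated])

lemma edges_at_eq_image_nbrs:
  assumes "simple_graph V E"
  shows "{e \<in> E. v \<in> e} = (\<lambda>w. {v, w}) ` nbrs E v"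
  by (auto simp: nbrs_def elim: simple_graph_edge_at[OF assms])

lemma inj_on_pair: "inj_on (\<lambda>w. {v, w}) A"
  by (auto simp: inj_on_def doubleton_eq_iff)

lemma degree_eq_card_nbrs:
  assumes "simple_graph V E"
  shows "degree E v = card (nbrs E v)"
  by (simp add: degree_def edges_at_eq_image_nbrs[OF assms] card_image[OF inj_on_pair])

lemma degree_split:
  assumes "simple_graph V E" "w \<noteq> v"
  shows "degree E w = card {e \<in> E. v \<notin> e \<and> w \<in> e} + of_bool (w \<in> nbrs E v)"
proof -
  let ?at = "if w \<in> nbrs E v then {{v, w}} else {}"
  have "{e \<in> E. w \<in> e} = {e \<in> E. v \<notin> e \<and> w \<in> e} \<union> ?at"
    using assms(2) by (auto simp: nbrs_def elim: simple_graph_edge_at[OF assms(1)])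
  moreover have "{e \<in> E. v \<notin> e \<and> w \<in> e} \<inter> ?at = {}"
    by auto
  ultimately show ?thesis
    unfolding degree_def using simple_graph_finite_edges[OF assms(1)]
    by (auto simp: card_Un_disjoint)
qed

text \<open>Double counting of incidences. The edge subset and the general semiring serve three
  uses: the handshake identity, the half costs of the edges off \<open>v\<close>, and the count of
  edge ends among the neighbours of \<open>v\<close>.\<close>

lemma sum_edges_sum_ends:
  fixes f :: "'a \<Rightarrow> 'b::comm_semiring_1"
  assumes "simple_graph V E" "F \<subseteq> E"
  shows "(\<Sum>e\<in>F. \<Sum>x\<in>e. f x) = (\<Sum>x\<in>V. of_nat (card {e \<in> F. x \<in> e}) * f x)"
proof -
  have fin: "finite F" "finite V"
    using assms finite_subset[OF assms(2) simple_graph_finite_edges]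
    by (auto simp: simple_graph_def)
  have "(\<Sum>e\<in>F. \<Sum>x\<in>e. f x) = (\<Sum>e\<in>F. \<Sum>x | x \<in> V \<and> x \<in> e. f x)"
    using assms by (intro sum.cong) (auto elim: simple_graph_edgeE)
  also have "\<dots> = (\<Sum>x\<in>V. \<Sum>e | e \<in> F \<and> x \<in> e. f x)"
    by (rule sum.swap_restrict[OF fin])
  finally show ?thesis by simp
qed

lemma handshake:
  assumes "simple_graph V E"
  shows "(\<Sum>v\<in>V. degree E v) = 2 * card E"
  using sum_edges_sum_ends[OF assms subset_refl, of "\<lambda>_. 1::nat"] simple_graph_edge_card[OF assms]
  by (simp add: degree_def)

lemma connected_closed_subset:
  assumes "connected_graph V E" "x \<in> V" "x \<in> S" "\<And>y. y \<in> S \<Longrightarrow> nbrs E y \<subseteq> S"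
  shows "V \<subseteq> S"
proof
  fix z assume "z \<in> V"
  then have "(adj E)\<^sup>*\<^sup>* x z"
    using assms unfolding connected_graph_def by blast
  then show "z \<in> S"
    by (induction rule: rtranclp_induct) (use assms in \<open>auto simp: adj_def nbrs_def\<close>)
qed

lemma connected_degree_pos:
  assumes "simple_graph V E" "connected_graph V E" "x \<in> V" "y \<in> V" "x \<noteq> y"
  shows "0 < degree E x"
proof (rule ccontr)
  assume "\<not> 0 < degree E x"
  then have "nbrs E x = {}"
    using simple_graph_finite_nbrs[OF assms(1)] by (simp add: degree_eq_card_nbrs[OF assms(1)])
  then have "V \<subseteq> {x}"
    by (intro connected_closed_subset[OF assms(2,3)]) auto
  then show False
    using assms by blast
qed

text \<open>Two adjacent leaves would form a whole component, leaving no room for \<open>v\<close>.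
  This excludes the one kind of edge for which two half costs do not suffice.\<close>

lemma connected_no_leaf_pair:
  assumes "simple_graph V E" "connected_graph V E" "{x, y} \<in> E" "v \<in> V" "v \<notin> {x, y}"
    and "degree E x = 1"
  shows "degree E y \<noteq> 1"
proof
  assume "degree E y = 1"
  have "y \<in> nbrs E x" "x \<in> nbrs E y"
    using assms(3) by (auto simp: nbrs_def insert_commute)
  then have "nbrs E x = {y}" "nbrs E y = {x}"
    using assms(6) \<open>degree E y = 1\<close> unfolding degree_eq_card_nbrs[OF assms(1)]
    by (auto simp: card_1_singleton_iff)
  moreover have "x \<in> V"
    using assms by (auto simp: nbrs_def intro: simple_graph_nbrs[of V E y])
  ultimately have "V \<subseteq> {x, y}"
    by (intro connected_closed_subset[OF assms(2)]) auto
  then show False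
    using assms by blast
qed

text \<open>The vertices of $R$ are absorbed one at a time, each along an edge to the part already reached.\<close>
lemma connected_card_touching:
  assumes "simple_graph V E" "connected_graph V E"
  shows "x \<in> V \<Longrightarrow> x \<notin> R \<Longrightarrow> R \<subseteq> V \<Longrightarrow> card R \<le> card {e \<in> E. e \<inter> R \<noteq> {}}"
proof (induction "card R" arbitrary: R)
  case 0
  then show ?case by simp
next
  case (Suc m)
  have finR: "finite R" and finE: "finite E"
    using Suc simple_graph_finite_edges assms(1) by (metis card.infinite nat.distinct(1), blast)
  have "\<exists>s r. s \<in> V - R \<and> r \<in> R \<and> {s, r} \<in> E"
  proof (rule ccontr)
    assume "\<not> ?thesis"
    then have "V \<subseteq> V - R"
      using Suc.prems
      by (intro connected_closed_subset[OF assms(2), of x])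
         (auto simp: nbrs_def intro: simple_graph_nbrs[OF assms(1)])
    then have "R = {}"
      using Suc.prems by blast
    then show False
      using Suc.hyps(2) by simp
  qed
  then obtain s r where sr: "s \<in> V - R" "r \<in> R" "{s, r} \<in> E"
    by blast
  have m: "m = card (R - {r})"
    using Suc.hyps(2) finR sr by simp
  then have "m \<le> card {e \<in> E. e \<inter> (R - {r}) \<noteq> {}}"
    using Suc.hyps(1)[OF m] Suc.prems by auto
  then have "Suc m \<le> Suc (card {e \<in> E. e \<inter> (R - {r}) \<noteq> {}})"
    by simp
  \<comment> \<open>The edge \<open>{s, r}\<close> meets \<open>R\<close> only in \<open>r\<close>,
    so it is not among the edges counted for \<open>R - {r}\<close>.\<close>
  also have "\<dots> = card (insert {s, r} {e \<in> E. e \<inter> (R - {r}) \<noteq> {}})"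
    using finE sr by simp
  also have "\<dots> \<le> card {e \<in> E. e \<inter> R \<noteq> {}}"
    using finE sr by (intro card_mono) auto
  finally show ?case
    using Suc.hyps by simp
qed

section \<open>Local accounting at a vertex\<close>

text \<open>The value at degree $1$ makes an edge between degrees $1$ and $2$ tight.\<close>
definition half_cost :: "real \<Rightarrow> nat \<Rightarrow> real" where
  "half_cost a d = (if d = 1 then 3 powr a - 4 powr a / 2 else (2 * real d) powr a / 2)"

text \<open>The gain in the index when a pendant vertex at \<open>v\<close> is prolonged to a path
  on two vertices while an edge between two vertices of degree 2 is given up elsewhere: the costs
  $(D+1)^a + 4^a$ become $(D+2)^a + 3^a$.\<close>

definition leaf_loss :: "real \<Rightarrow> nat \<Rightarrow> real" where
  "leaf_loss a D = (3 powr a - 4 powr a) - ((real D + 1) powr a - (real D + 2) powr a)"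

definition leaf_nbrs :: "'a set set \<Rightarrow> 'a \<Rightarrow> 'a set" where
  "leaf_nbrs E v = {w \<in> nbrs E v. degree E w = 1}"

lemma edge_cost_le:
  fixes x y :: nat
  assumes "a < 0" "0 < x" "0 < y" "\<not> (x = 1 \<and> y = 1)"
  shows "real (x + y) powr a \<le> half_cost a x + half_cost a y"
proof -
  have main: "(real x + real y) powr a \<le> ((2 * real x) powr a + (2 * real y) powr a) / 2"
    if "0 < x" "0 < y" for x y :: nat
  proof -
    have "(2 * real x + 2 * real y) / 2 = real x + real y"
      by simp
    then show ?thesis
      using powr_neg_midpoint[of a "2 * real x" "2 * real y"] that assms(1) by (simp only:)
  qed
  \<comment> \<open>A leaf edge exceeds the edge from degree 2 to degree \<open>y\<close> by the
    drop from \<open>1 + y\<close> to \<open>2 + y\<close>. This drop is largest at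
    \<open>y = 2\<close>, which is the case used to calibrate \<open>half_cost a 1\<close>.\<close>
  have leaf: "(1 + real y) powr a \<le> half_cost a 1 + half_cost a y" if "2 \<le> y" for y :: nat
  proof -
    have "(1 + real y) powr a - (2 + real y) powr a \<le> 3 powr a - 4 powr a"
      using powr_neg_drop[of a 3 "1 + real y"] that assms(1) by (simp add: add_ac)
    moreover have "(2 + real y) powr a \<le> (4 powr a + (2 * real y) powr a) / 2"
      using main[of 2 y] that by simp
    ultimately show ?thesis
      using that by (simp add: half_cost_def)
  qed
  consider "x = 1" "2 \<le> y" | "y = 1" "2 \<le> x" | "2 \<le> x" "2 \<le> y"
    using assms by linarith
  then show ?thesis
  proof cases
    case 1 then show ?thesis using leaf[of y] by simp
  next
    case 2 then show ?thesis using leaf[of x] by (simp add: add_ac)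
  next
    case 3 then show ?thesis using main[of x y] by (simp add: half_cost_def)
  qed
qed

lemma edge_cost_eq:
  fixes x y :: nat
  assumes "0 < x" "0 < y" "\<not> (x = 1 \<and> y = 1)" "x \<le> 2" "y \<le> 2"
  shows "real (x + y) powr a = half_cost a x + half_cost a y"
proof -
  consider "x = 1" "y = 2" | "x = 2" "y = 1" | "x = 2" "y = 2"
    using assms by linarith
  then show ?thesis
    by cases (simp_all add: half_cost_def)
qed

text \<open>The slope $3 \cdot 4^a/2 - 3^a$ is forced by tightness at degrees $1$ and $2$ away from $v$; the
  two corrections restore tightness at the neighbours of $v$.\<close>
definition vertex_allowance :: "real \<Rightarrow> nat \<Rightarrow> bool \<Rightarrow> nat \<Rightarrow> real" where
  "vertex_allowance a D near d = 4 powr a + (real d - 2) * (3 * 4 powr a / 2 - 3 powr a) +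
     (if near then (real D + 2) powr a - 4 powr a / 2 else 0) -
     (if near \<and> d = 1 then leaf_loss a D else 0)"

text \<open>Edges at \<open>v\<close> are not split: their full cost goes to the other end, so a
  neighbour of \<open>v\<close> collects one half cost fewer and \<open>v\<close> itself carries
  nothing. \<open>D\<close> stands for the degree of \<open>v\<close>.\<close>

definition vertex_cost :: "real \<Rightarrow> nat \<Rightarrow> bool \<Rightarrow> nat \<Rightarrow> real" where
  "vertex_cost a D near d = (real d - of_bool near) * half_cost a d +
     (if near then (real D + real d) powr a else 0)"

lemma vertex_cost_eq: "d = 1 \<or> d = 2 \<Longrightarrow> vertex_cost a D near d = vertex_allowance a D near d"
  by (auto simp: vertex_cost_def vertex_allowance_def half_cost_def leaf_loss_def field_simps)

text \<open>For a neighbour of \<open>v\<close>, \<open>branch_vertex_cost\<close> is exactly the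
  comparison without the edge to \<open>v\<close>, and that edge supplies the strictness. For any
  other vertex there is one half cost more, and its fall below the value at degree 2 supplies
  it.\<close>

lemma vertex_cost_less:
  assumes "-1 \<le> a" "a < 0" "3 \<le> d"
  shows "vertex_cost a D near d < vertex_allowance a D near d"
proof -
  have h: "half_cost a d = (2 * real d) powr a / 2"
    using assms by (simp add: half_cost_def)
  have b: "(real d - 2) * (3 powr a - 4 powr a) \<le> (real d - 1) * (4 powr a - (2 * real d) powr a) / 2"
    by (rule branch_vertex_cost[OF assms])
  show ?thesis
  proof (cases near)
    case True
    have "(real D + real d) powr a < (real D + 2) powr a"
      using assms by (intro powr_less_mono2_neg) auto
    then show ?thesis
      using b True assms by (simp add: vertex_cost_def vertex_allowance_def h field_simps)
  next
    case False
    have "(2 * real d) powr a < 4 powr a"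
      using assms by (intro powr_less_mono2_neg) auto
    then show ?thesis
      using b False by (simp add: vertex_cost_def vertex_allowance_def h field_simps)
  qed
qed

text \<open>The difference of the two sides is a sum of nonnegative slacks, one for each edge off
  \<open>v\<close> and one for each vertex other than \<open>v\<close>. A vertex slack vanishes
  exactly at degree at most 2, and if all of them vanish then so do the edge slacks; hence the
  vertices alone decide equality.\<close>

lemma chi_accounting:
  fixes V :: "'a set" and E :: "'a set set" and a :: real
  defines "T \<equiv> \<lambda>v. real (degree E v) * (real (degree E v) + 2) powr a
      + (real (card V) - real (degree E v)) * 4 powr a
      + (real (degree E v) - 2) * (3 powr a - 4 powr a)
      - real (card (leaf_nbrs E v)) * leaf_loss a (degree E v)"
  assumes G: "simple_graph V E" "connected_graph V E" "card E = card V"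
    and v: "v \<in> V" "2 \<le> degree E v" and a: "-1 \<le> a" "a < 0"
  shows "chi a E \<le> T v" and "chi a E = T v \<longleftrightarrow> (\<forall>w\<in>V - {v}. degree E w \<le> 2)"
proof -
  define D where "D = degree E v"
  define N where "N = nbrs E v"
  define E0 where "E0 = {e \<in> E. v \<notin> e}"
  define W where "W = V - {v}"
  let ?d = "degree E"
  have finV: "finite V" and finE: "finite E" and finN: "finite N"
    using G(1) simple_graph_finite_edges[OF G(1)] simple_graph_finite_nbrs[OF G(1)]
    by (auto simp: simple_graph_def N_def)
  have finE0: "finite E0" and finW: "finite W"
    using finV finE by (auto simp: E0_def W_def)
  have NW: "N \<subseteq> W"
    using simple_graph_nbrs[OF G(1)] unfolding N_def W_def by blast
  have cN: "card N = D"
    by (simp add: N_def D_def degree_eq_card_nbrs[OF G(1)])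
  have pos: "0 < ?d w" if "w \<in> V" for w
  proof (cases "w = v")
    case True then show ?thesis using v by simp
  next
    case False then show ?thesis using connected_degree_pos[OF G(1,2) that v(1)] by simp
  qed
  have E0_deg: "real (card {e \<in> E0. w \<in> e}) = real (?d w) - of_bool (w \<in> N)" if "w \<in> W" for w
    using degree_split[OF G(1), of w v] that by (simp add: E0_def W_def N_def conj_ac)
  define sE where "sE e = (\<Sum>x\<in>e. half_cost a (?d x)) - real (\<Sum>x\<in>e. ?d x) powr a" for e
  define sW where "sW w = vertex_allowance a D (w \<in> N) (?d w) - vertex_cost a D (w \<in> N) (?d w)" for w
  have "(\<Sum>e\<in>E0. \<Sum>x\<in>e. half_cost a (?d x))
      = (\<Sum>x\<in>V. real (card {e \<in> E0. x \<in> e}) * half_cost a (?d x))"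
    by (rule sum_edges_sum_ends[OF G(1)]) (auto simp: E0_def)
  also have "\<dots> = (\<Sum>x\<in>W. real (card {e \<in> E0. x \<in> e}) * half_cost a (?d x))"
  proof (rule sum.mono_neutral_right)
    have "{e \<in> E0. v \<in> e} = {}" by (auto simp: E0_def)
    then have "real (card {e \<in> E0. v \<in> e}) * half_cost a (?d v) = 0"
      by (metis card.empty mult_zero_left of_nat_0)
    then show "\<forall>x\<in>V - W. real (card {e \<in> E0. x \<in> e}) * half_cost a (?d x) = 0"
      unfolding W_def by blast
  qed (use finV in \<open>auto simp: W_def\<close>)
  also have "\<dots> = (\<Sum>w\<in>W. (real (?d w) - of_bool (w \<in> N)) * half_cost a (?d w))"
    by (intro sum.cong) (simp_all add: E0_deg)
  finally have half: "(\<Sum>e\<in>E0. \<Sum>x\<in>e. half_cost a (?d x))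
      = (\<Sum>w\<in>W. (real (?d w) - of_bool (w \<in> N)) * half_cost a (?d w))" .
  have ends: "real (\<Sum>x\<in>{v, w}. ?d x) = real D + real (?d w)" if "w \<in> N" for w
  proof -
    have "v \<noteq> w"
      using NW that by (auto simp: W_def)
    then show ?thesis
      by (simp add: D_def)
  qed
  have "chi a E = (\<Sum>e\<in>E0. real (\<Sum>x\<in>e. ?d x) powr a) + (\<Sum>e\<in>{e \<in> E. v \<in> e}. real (\<Sum>x\<in>e. ?d x) powr a)"
    unfolding chi_def by (subst sum.union_disjoint[symmetric])
      (use finE in \<open>auto simp: E0_def intro: sum.cong\<close>)
  also have "(\<Sum>e\<in>{e \<in> E. v \<in> e}. real (\<Sum>x\<in>e. ?d x) powr a) = (\<Sum>w\<in>N. (real D + real (?d w)) powr a)"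
  proof -
    have "(\<Sum>e\<in>{e \<in> E. v \<in> e}. real (\<Sum>x\<in>e. ?d x) powr a)
        = (\<Sum>w\<in>N. real (\<Sum>x\<in>{v, w}. ?d x) powr a)"
      unfolding edges_at_eq_image_nbrs[OF G(1)] N_def sum.reindex[OF inj_on_pair] o_def ..
    also have "\<dots> = (\<Sum>w\<in>N. (real D + real (?d w)) powr a)"
      by (intro sum.cong refl) (simp only: ends)
    finally show ?thesis .
  qed
  also have "\<dots> = (\<Sum>w\<in>W. if w \<in> N then (real D + real (?d w)) powr a else 0)"
    using NW finW by (simp add: sum.If_cases Int_absorb1)
  finally have chi: "chi a E = (\<Sum>e\<in>E0. real (\<Sum>x\<in>e. ?d x) powr a)
      + (\<Sum>w\<in>W. if w \<in> N then (real D + real (?d w)) powr a else 0)" .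
  have leaves: "{w \<in> W. w \<in> N \<and> ?d w = 1} = leaf_nbrs E v"
    using NW by (auto simp: leaf_nbrs_def N_def)
  have cW: "real (card W) = real (card V) - 1"
    using v finV card_gt_0_iff[of V] by (auto simp: W_def of_nat_diff)
  \<comment> \<open>Here \<open>card E = card V\<close> enters: the excesses over degree 2 cancel
    over \<open>V\<close>, so those off \<open>v\<close> add up to \<open>2 - D\<close> and the
    affine part of the allowance sums to a constant.\<close>
  have "(\<Sum>w\<in>V. real (?d w)) = 2 * real (card V)"
    using handshake[OF G(1)] G(3) by (metis of_nat_sum of_nat_mult of_nat_numeral)
  then have "(\<Sum>w\<in>W. real (?d w)) = 2 * real (card V) - real D"
    using finV v(1) by (simp add: W_def D_def sum_diff1)
  then have dsum: "(\<Sum>w\<in>W. real (?d w) - 2) = 2 - real D"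
    by (simp add: sum_subtractf cW)
  have "(\<Sum>w\<in>W. vertex_allowance a D (w \<in> N) (?d w))
     = real (card W) * 4 powr a + (2 - real D) * (3 * 4 powr a / 2 - 3 powr a)
       + real D * ((real D + 2) powr a - 4 powr a / 2) - real (card (leaf_nbrs E v)) * leaf_loss a D"
  proof -
    have "(\<Sum>w\<in>W. (real (?d w) - 2) * K) = (2 - real D) * K" for K
      unfolding sum_distrib_right[symmetric] dsum ..
    moreover have "(\<Sum>w\<in>W. if w \<in> N then K else 0) = real D * K" for K :: real
      using NW finW cN by (simp add: sum.If_cases Int_absorb1)
    moreover have "(\<Sum>w\<in>W. if w \<in> N \<and> ?d w = 1 then K else 0) = real (card (leaf_nbrs E v)) * K"
      for K :: real
      unfolding sum.inter_filter[OF finW, symmetric] leaves by simp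
    ultimately show ?thesis
      unfolding vertex_allowance_def sum_subtractf sum.distrib by (simp only: sum_constant)
  qed
  also have "\<dots> = T v"
    unfolding T_def cW D_def[symmetric] by (simp add: field_simps)
  finally have allow: "(\<Sum>w\<in>W. vertex_allowance a D (w \<in> N) (?d w)) = T v" .
  have T: "T v - chi a E = sum sE E0 + sum sW W"
    unfolding allow[symmetric] chi sE_def sW_def sum_subtractf half vertex_cost_def sum.distrib by simp
  have E0E: "\<exists>x y. e = {x, y} \<and> x \<noteq> y \<and> x \<in> W \<and> y \<in> W \<and> \<not> (?d x = 1 \<and> ?d y = 1)" if "e \<in> E0" for e
  proof -
    have "e \<in> E" using that by (simp add: E0_def)
    then obtain x y where xy: "x \<in> V" "y \<in> V" "x \<noteq> y" "e = {x, y}"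
      using simple_graph_edgeE[OF G(1)] by blast
    have "?d y \<noteq> 1" if "?d x = 1"
      by (rule connected_no_leaf_pair[OF G(1,2) _ v(1)])
         (use xy that \<open>e \<in> E\<close> \<open>e \<in> E0\<close> in \<open>auto simp: E0_def\<close>)
    then show ?thesis
      using xy that by (auto simp: E0_def W_def)
  qed
  have W_V: "w \<in> V" if "w \<in> W" for w
    using that by (simp add: W_def)
  have sE: "0 \<le> sE e" and sE0: "\<forall>w\<in>W. ?d w \<le> 2 \<Longrightarrow> sE e = 0" if e0: "e \<in> E0" for e
  proof -
    obtain x y where e: "e = {x, y}" "x \<noteq> y" and W: "x \<in> W" "y \<in> W"
      and nl: "\<not> (?d x = 1 \<and> ?d y = 1)"
      using E0E[OF e0] by blast
    have "sE e = half_cost a (?d x) + half_cost a (?d y) - real (?d x + ?d y) powr a"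
      unfolding sE_def e(1) using e(2) by simp
    then show "0 \<le> sE e" "\<forall>w\<in>W. ?d w \<le> 2 \<Longrightarrow> sE e = 0"
      using edge_cost_le[OF a(2) pos[OF W_V] pos[OF W_V] nl, OF W]
        edge_cost_eq[OF pos[OF W_V] pos[OF W_V] nl, OF W, of a] W by simp_all
  qed
  have sW: "0 \<le> sW w" "sW w = 0 \<longleftrightarrow> ?d w \<le> 2" if "w \<in> W" for w
  proof -
    have "?d w = 1 \<or> ?d w = 2 \<or> 3 \<le> ?d w"
      using pos[OF W_V[OF that]] by linarith
    then show "0 \<le> sW w" "sW w = 0 \<longleftrightarrow> ?d w \<le> 2"
      using vertex_cost_eq[of "?d w" a D "w \<in> N"] vertex_cost_less[OF a, of "?d w" D "w \<in> N"]
      by (auto simp: sW_def)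
  qed
  have nn: "0 \<le> sum sE E0" "0 \<le> sum sW W"
    using sE sW by (auto intro: sum_nonneg)
  then show "chi a E \<le> T v"
    using T by linarith
  show "chi a E = T v \<longleftrightarrow> (\<forall>w\<in>V - {v}. ?d w \<le> 2)"
  proof
    assume "chi a E = T v"
    then have "sum sW W = 0"
      using T nn by linarith
    then show "\<forall>w\<in>V - {v}. ?d w \<le> 2"
      using sum_nonneg_eq_0_iff[OF finW, of sW] sW by (auto simp: W_def)
  next
    assume "\<forall>w\<in>V - {v}. ?d w \<le> 2"
    then have "sum sE E0 = 0" "sum sW W = 0"
      using sE0 sW by (auto simp: W_def)
    then show "chi a E = T v"
      using T by simp
  qed
qed

text \<open>At most one edge joins two neighbours of $v$, since by connectivity the edges meeting the
  complement $R$ of the closed neighbourhood number at least $|R|$. The remaining $|R| + 1$ edges off $v$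
  have to serve all non-leaf neighbours.\<close>
lemma card_leaf_nbrs_ge:
  assumes G: "simple_graph V E" "connected_graph V E" "card E = card V" and v: "v \<in> V"
  shows "2 * degree E v \<le> card V + 1 + card (leaf_nbrs E v)"
proof -
  define D where "D = degree E v"
  define N where "N = nbrs E v"
  define E0 where "E0 = {e \<in> E. v \<notin> e}"
  define R where "R = V - insert v N"
  define T where "T = {e \<in> E. e \<inter> R \<noteq> {}}"
  have finV: "finite V" and finE: "finite E" and finN: "finite N"
    using G(1) simple_graph_finite_edges[OF G(1)] simple_graph_finite_nbrs[OF G(1)]
    by (auto simp: simple_graph_def N_def)
  then have finE0: "finite E0"
    by (simp add: E0_def)
  have NV: "insert v N \<subseteq> V" "v \<notin> N"
    using v simple_graph_nbrs[OF G(1)] unfolding N_def by blast+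
  have cN: "card N = D"
    by (simp add: N_def D_def degree_eq_card_nbrs[OF G(1)])
  have "card (insert v N) + card R = card V"
    using card_Diff_subset[OF _ NV(1)] card_mono[OF finV NV(1)] finN by (simp add: R_def)
  then have cR: "Suc D + card R = card V"
    using NV finN cN by simp
  have cE0: "card E0 + D = card V"
  proof -
    have "E = E0 \<union> {e \<in> E. v \<in> e}" "E0 \<inter> {e \<in> E. v \<in> e} = {}"
      by (auto simp: E0_def)
    then have "card E = card E0 + card {e \<in> E. v \<in> e}"
      using finE card_Un_disjoint[of E0 "{e \<in> E. v \<in> e}"] finE0 by auto
    then show ?thesis
      using G(3) by (simp add: D_def degree_def)
  qed
  have TE0: "T \<subseteq> E0"
  proof
    fix e assume "e \<in> T"
    then have e: "e \<in> E" "e \<inter> R \<noteq> {}"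
      by (auto simp: T_def)
    have "v \<notin> e"
    proof
      assume "v \<in> e"
      then obtain y where "e = {v, y}"
        using simple_graph_edge_at[OF G(1) e(1)] by metis
      then show False
        using e by (auto simp: R_def N_def nbrs_def)
    qed
    then show "e \<in> E0"
      using e by (simp add: E0_def)
  qed
  have "card R \<le> card T"
    unfolding T_def by (rule connected_card_touching[OF G(1,2) v]) (auto simp: R_def)
  moreover have "card (E0 - T) + card T = card E0"
    using card_Diff_subset[OF finite_subset[OF TE0 finE0] TE0] card_mono[OF finE0 TE0] by simp
  ultimately have q: "card (E0 - T) \<le> 1"
    using cE0 cR by linarith
  have LN: "leaf_nbrs E v \<subseteq> N"
    by (auto simp: leaf_nbrs_def N_def)
  have "N - leaf_nbrs E v = N \<inter> {x. degree E x \<noteq> 1}"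
    by (auto simp: leaf_nbrs_def N_def)
  then have "card (N - leaf_nbrs E v) = (\<Sum>x\<in>N. of_bool (degree E x \<noteq> 1))"
    using finN by (simp only: sum_of_bool_eq of_nat_id)
  also have "\<dots> \<le> (\<Sum>x\<in>N. card {e \<in> E0. x \<in> e})"
  proof (rule sum_mono)
    fix x assume x: "x \<in> N"
    then have "0 < degree E x"
      using connected_degree_pos[OF G(1,2) _ v, of x] NV by auto
    moreover have "degree E x = card {e \<in> E0. x \<in> e} + 1"
      using degree_split[OF G(1), of x v] x NV by (auto simp: E0_def N_def conj_ac)
    ultimately show "of_bool (degree E x \<noteq> 1) \<le> card {e \<in> E0. x \<in> e}"
      by (cases "card {e \<in> E0. x \<in> e}") auto
  qed
  also have "\<dots> = (\<Sum>x\<in>V. card {e \<in> E0. x \<in> e} * of_bool (x \<in> N))"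
    by (rule sum.mono_neutral_cong_left) (use NV finV in auto)
  also have "\<dots> = (\<Sum>e\<in>E0. \<Sum>x\<in>e. of_bool (x \<in> N))"
    using sum_edges_sum_ends[OF G(1), of E0 "\<lambda>x. of_bool (x \<in> N) :: nat"] by (simp add: E0_def)
  \<comment> \<open>An edge in \<open>T\<close> has an end in \<open>R\<close>, hence at most one
    end in \<open>N\<close>; only an edge outside \<open>T\<close> can serve two neighbours of
    \<open>v\<close>.\<close>
  also have "\<dots> \<le> (\<Sum>e\<in>E0. 1 + of_bool (e \<notin> T))"
  proof (rule sum_mono)
    fix e assume e: "e \<in> E0"
    then have "e \<in> E"
      by (simp add: E0_def)
    then obtain x y where xy: "x \<noteq> y" "e = {x, y}"
      using simple_graph_edgeE[OF G(1)] by metis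
    then have "(\<Sum>x\<in>e. of_bool (x \<in> N)) = (of_bool (x \<in> N) + of_bool (y \<in> N) :: nat)"
      by simp
    moreover have "x \<notin> N \<or> y \<notin> N" if "e \<in> T"
      using that xy by (auto simp: T_def R_def)
    ultimately show "(\<Sum>x\<in>e. of_bool (x \<in> N)) \<le> (1 + of_bool (e \<notin> T) :: nat)"
      by (auto simp only: of_bool_def split: if_splits)
  qed
  also have "\<dots> = card E0 + card (E0 - T)"
  proof -
    have "E0 \<inter> {e. e \<notin> T} = E0 - T"
      by auto
    then show ?thesis
      unfolding sum.distrib using finE0 by simp
  qed
  finally have "card (N - leaf_nbrs E v) \<le> card E0 + 1"
    using q by linarith
  moreover have "card (N - leaf_nbrs E v) + card (leaf_nbrs E v) = D"
    using card_Diff_subset[OF finite_subset[OF LN finN] LN] card_mono[OF finN LN] cN by simp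
  ultimately show ?thesis
    using cE0 by (simp add: D_def)
qed

section \<open>Cycles with branches at one vertex\<close>

definition path_edges :: "'a list \<Rightarrow> 'a set set" where
  "path_edges xs = {{xs ! i, xs ! Suc i} | i. Suc i < length xs}"

definition cycle_edges :: "'a list \<Rightarrow> 'a set set" where
  "cycle_edges c = {{c ! i, c ! (Suc i mod length c)} | i. i < length c}"

definition branch_edges :: "'a \<Rightarrow> 'a list \<Rightarrow> 'a set set" where
  "branch_edges r b = insert {r, hd b} (path_edges b)"

text \<open>Ordered lists are used so that prolonging a branch is appending to a list, and so that
  positions in \<open>c @ concat bs\<close> number the vertices in the layout of
  \<open>cyc_paths_V\<close>. The root is the head of \<open>c\<close>.\<close>

definition cycle_with_branches :: "'a set \<Rightarrow> 'a set set \<Rightarrow> 'a list \<Rightarrow> 'a list list \<Rightarrow> bool" where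
  "cycle_with_branches V E c bs \<longleftrightarrow> 3 \<le> length c \<and> distinct (c @ concat bs) \<and> set (c @ concat bs) = V
     \<and> (\<forall>b\<in>set bs. b \<noteq> []) \<and> E = cycle_edges c \<union> (\<Union>b\<in>set bs. branch_edges (hd c) b)"

lemma path_edges_subset: "e \<in> path_edges xs \<Longrightarrow> e \<subseteq> set xs"
  by (auto simp: path_edges_def)

lemma cycle_edges_subset: "e \<in> cycle_edges c \<Longrightarrow> e \<subseteq> set c"
  by (cases "length c = 0") (auto simp: cycle_edges_def)

lemma path_edges_snoc:
  assumes "xs \<noteq> []"
  shows "path_edges (xs @ [x]) = insert {last xs, x} (path_edges xs)"
proof (intro equalityI subsetI)
  fix e assume "e \<in> path_edges (xs @ [x])"
  then obtain i where i: "e = {(xs @ [x]) ! i, (xs @ [x]) ! Suc i}" "i < length xs"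
    by (auto simp: path_edges_def)
  show "e \<in> insert {last xs, x} (path_edges xs)"
  proof (cases "Suc i = length xs")
    case True
    then show ?thesis
      using i assms by (simp add: nth_append last_conv_nth flip: True)
  next
    case False
    then show ?thesis
      using i by (auto simp: path_edges_def nth_append)
  qed
next
  fix e assume "e \<in> insert {last xs, x} (path_edges xs)"
  then consider "e = {last xs, x}" | i where "e = {xs ! i, xs ! Suc i}" "Suc i < length xs"
    by (auto simp: path_edges_def)
  then show "e \<in> path_edges (xs @ [x])"
  proof cases
    case 1
    then have "e = {(xs @ [x]) ! (length xs - 1), (xs @ [x]) ! Suc (length xs - 1)}"
      using assms by (simp add: nth_append last_conv_nth)
    then show ?thesis
      unfolding path_edges_def using assms by auto
  next
    case 2
    then have "e = {(xs @ [x]) ! i, (xs @ [x]) ! Suc i}"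
      by (simp add: nth_append)
    then show ?thesis
      unfolding path_edges_def using 2 by auto
  qed
qed

lemma nbrs_path_edges:
  assumes "distinct xs" "i < length xs" "z \<in> nbrs (path_edges xs) (xs ! i)"
  shows "(0 < i \<and> z = xs ! (i - 1)) \<or> (Suc i < length xs \<and> z = xs ! Suc i)"
proof -
  obtain j where "Suc j < length xs" "{xs ! i, z} = {xs ! j, xs ! Suc j}"
    using assms(3) by (auto simp: nbrs_def path_edges_def)
  then show ?thesis
    using assms(1,2) by (auto simp: doubleton_eq_iff nth_eq_iff_index_eq)
qed

text \<open>The predecessor modulo \<open>k\<close>; the case distinction avoids truncated
  subtraction at 0.\<close>

definition cyc_pred :: "nat \<Rightarrow> nat \<Rightarrow> nat" where
  "cyc_pred k i = (if i = 0 then k - 1 else i - 1)"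

lemma Suc_cyc_pred: "i < k \<Longrightarrow> Suc (cyc_pred k i) mod k = i"
  by (auto simp: cyc_pred_def mod_Suc)

lemma cyc_pred_less: "i < k \<Longrightarrow> cyc_pred k i < k"
  by (auto simp: cyc_pred_def)

lemma cyc_pred_unique: "i < k \<Longrightarrow> j < k \<Longrightarrow> Suc j mod k = i \<Longrightarrow> j = cyc_pred k i"
  by (auto simp: cyc_pred_def mod_Suc split: if_splits)

text \<open>For \<open>k = 2\<close> the two cyclic neighbours coincide; three vertices are what
  gives each cycle vertex degree at least 2.\<close>

lemma cyc_pred_neq: "3 \<le> k \<Longrightarrow> i < k \<Longrightarrow> cyc_pred k i \<noteq> Suc i mod k"
  by (auto simp: cyc_pred_def mod_Suc)

lemma nbrs_cycle_edges:
  assumes "distinct c" "i < length c"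
  shows "nbrs (cycle_edges c) (c ! i) = {c ! cyc_pred (length c) i, c ! (Suc i mod length c)}"
proof (intro equalityI subsetI)
  let ?k = "length c"
  fix z assume "z \<in> nbrs (cycle_edges c) (c ! i)"
  then obtain j where j: "j < ?k" "{c ! i, z} = {c ! j, c ! (Suc j mod ?k)}"
    by (auto simp: nbrs_def cycle_edges_def)
  then consider "c ! i = c ! j" "z = c ! (Suc j mod ?k)" | "c ! i = c ! (Suc j mod ?k)" "z = c ! j"
    by (auto simp: doubleton_eq_iff)
  then show "z \<in> {c ! cyc_pred ?k i, c ! (Suc i mod ?k)}"
  proof cases
    case 1
    then show ?thesis
      using assms j(1) by (simp add: nth_eq_iff_index_eq)
  next
    case 2
    have "Suc j mod ?k < ?k"
      using assms(2) by (intro mod_less_divisor) auto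
    then have "Suc j mod ?k = i"
      using 2 assms by (simp add: nth_eq_iff_index_eq)
    then show ?thesis
      using 2 cyc_pred_unique[OF assms(2) j(1)] by simp
  qed
next
  let ?k = "length c"
  fix z assume "z \<in> {c ! cyc_pred ?k i, c ! (Suc i mod ?k)}"
  moreover have "{c ! i, c ! cyc_pred ?k i} \<in> cycle_edges c"
    unfolding cycle_edges_def using Suc_cyc_pred[OF assms(2)] cyc_pred_less[OF assms(2)]
    by (auto simp: insert_commute intro!: exI[of _ "cyc_pred ?k i"])
  moreover have "{c ! i, c ! (Suc i mod ?k)} \<in> cycle_edges c"
    unfolding cycle_edges_def using assms(2) by auto
  ultimately show "z \<in> nbrs (cycle_edges c) (c ! i)"
    by (auto simp: nbrs_def)
qed

lemma card_nbrs_cycle_edges: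
  assumes "distinct c" "3 \<le> length c" "x \<in> set c"
  shows "card (nbrs (cycle_edges c) x) = 2"
proof -
  obtain i where i: "i < length c" "x = c ! i"
    using assms(3) by (auto simp: in_set_conv_nth)
  have "Suc i mod length c < length c"
    using i by (intro mod_less_divisor) auto
  then have "c ! cyc_pred (length c) i \<noteq> c ! (Suc i mod length c)"
    using assms i cyc_pred_neq cyc_pred_less[OF i(1)] by (simp add: nth_eq_iff_index_eq)
  then show ?thesis
    using nbrs_cycle_edges[OF assms(1) i(1)] i by simp
qed

section \<open>Degrees in a cycle with branches\<close>

context
  fixes V :: "'a set" and E :: "'a set set" and c :: "'a list" and bs :: "'a list list"
  assumes G: "simple_graph V E" and cwb: "cycle_with_branches V E c bs"
begin

lemma cwb_distinct:
  shows "distinct c" "b \<in> set bs \<Longrightarrow> distinct b" "b \<in> set bs \<Longrightarrow> set c \<inter> set b = {}"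
    "b \<in> set bs \<Longrightarrow> b' \<in> set bs \<Longrightarrow> b \<noteq> b' \<Longrightarrow> set b \<inter> set b' = {}" "distinct bs"
proof -
  \<comment> \<open>\<open>distinct_concat_iff\<close> requires distinctness only of the nonempty
    members; since no branch is empty, this yields \<open>distinct bs\<close>.\<close>
  have "removeAll [] bs = bs"
    using cwb by (intro removeAll_id) (auto simp: cycle_with_branches_def)
  then show "distinct c" "b \<in> set bs \<Longrightarrow> distinct b" "b \<in> set bs \<Longrightarrow> set c \<inter> set b = {}"
    "b \<in> set bs \<Longrightarrow> b' \<in> set bs \<Longrightarrow> b \<noteq> b' \<Longrightarrow> set b \<inter> set b' = {}" "distinct bs"
    using cwb by (auto simp: cycle_with_branches_def distinct_concat_iff)
qed

lemma cwb_nonempty: "3 \<le> length c" "hd c \<in> set c" "b \<in> set bs \<Longrightarrow> b \<noteq> []"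
  using cwb by (cases c; auto simp: cycle_with_branches_def)+

lemma cwb_edges: "E = cycle_edges c \<union> (\<Union>b\<in>set bs. branch_edges (hd c) b)"
  using cwb by (simp add: cycle_with_branches_def)

lemma cwb_nbrs_cycle:
  assumes "x \<in> set c" "x \<noteq> hd c"
  shows "nbrs E x \<subseteq> nbrs (cycle_edges c) x"
proof
  fix z assume "z \<in> nbrs E x"
  then consider "{x, z} \<in> cycle_edges c" | b where "b \<in> set bs" "{x, z} = {hd c, hd b}"
    | b where "b \<in> set bs" "{x, z} \<in> path_edges b"
    using cwb_edges by (auto simp: nbrs_def branch_edges_def)
  then show "z \<in> nbrs (cycle_edges c) x"
  proof cases
    case 1
    then show ?thesis by (simp add: nbrs_def)
  next
    case 2
    then have "x = hd b" "hd b \<in> set b"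
      using assms cwb_nonempty(3) by (auto simp: doubleton_eq_iff)
    then show ?thesis
      using assms 2 cwb_distinct(3) by blast
  next
    case 3
    then show ?thesis
      using path_edges_subset[OF 3(2)] assms cwb_distinct(3) by blast
  qed
qed

lemma cwb_nbrs_branch:
  assumes "b \<in> set bs" "t < length b" "z \<in> nbrs E (b ! t)"
  shows "(t = 0 \<and> z = hd c) \<or> (0 < t \<and> z = b ! (t - 1)) \<or> (Suc t < length b \<and> z = b ! Suc t)"
proof -
  have x: "b ! t \<in> set b"
    using assms by simp
  consider "{b ! t, z} \<in> cycle_edges c" | b' where "b' \<in> set bs" "{b ! t, z} = {hd c, hd b'}"
    | b' where "b' \<in> set bs" "{b ! t, z} \<in> path_edges b'"
    using cwb_edges assms(3) by (auto simp: nbrs_def branch_edges_def)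
  then show ?thesis
  proof cases
    case 1
    then show ?thesis
      using cycle_edges_subset[OF 1] x assms(1) cwb_distinct(3) by blast
  next
    case 2
    have "b ! t \<notin> set c"
      using x cwb_distinct(3)[OF assms(1)] by auto
    then have "b ! t \<noteq> hd c"
      using cwb_nonempty(2) by auto
    then have *: "b ! t = hd b'" "z = hd c"
      using 2(2) by (auto simp: doubleton_eq_iff)
    then have "b' = b"
      using x cwb_distinct(4)[OF 2(1) assms(1)] cwb_nonempty(3)[OF 2(1)] hd_in_set[of b'] by (metis disjoint_iff)
    then have "b ! t = b ! 0"
      using * cwb_nonempty(3)[OF 2(1)] by (simp add: hd_conv_nth)
    then have "t = 0"
      using nth_eq_iff_index_eq[of b t 0] cwb_distinct(2)[OF assms(1)] assms(2)
        cwb_nonempty(3)[OF assms(1)] by simp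
    then show ?thesis
      using * by simp
  next
    case 3
    then have "b' = b"
      using path_edges_subset[OF 3(2)] x cwb_distinct(4)[OF 3(1) assms(1)] by auto
    then show ?thesis
      using nbrs_path_edges[OF cwb_distinct(2)[OF assms(1)] assms(2)] 3(2) by (auto simp: nbrs_def)
  qed
qed

lemma cwb_vertex_cases:
  assumes "x \<in> V"
  obtains "x \<in> set c" | b t where "b \<in> set bs" "t < length b" "x = b ! t"
proof -
  have "x \<in> set c \<or> (\<exists>b\<in>set bs. x \<in> set b)"
    using assms cwb by (auto simp: cycle_with_branches_def)
  then show ?thesis
    using that by (metis in_set_conv_nth)
qed

lemma cwb_degree_le:
  assumes "x \<in> V" "x \<noteq> hd c"
  shows "degree E x \<le> 2"
  using assms(1)
proof (cases rule: cwb_vertex_cases)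
  case 1
  have "card (nbrs (cycle_edges c) x) = 2"
    by (rule card_nbrs_cycle_edges[OF cwb_distinct(1) cwb_nonempty(1) 1])
  then show ?thesis
    using card_mono[OF _ cwb_nbrs_cycle[OF 1 assms(2)]] card_gt_0_iff[of "nbrs (cycle_edges c) x"]
    by (simp add: degree_eq_card_nbrs[OF G])
next
  case (2 b t)
  \<comment> \<open>At the far end of the branch \<open>b ! Suc t\<close> is out of range and its
    value unspecified. This can only enlarge the set, which is harmless for an upper bound.\<close>
  have "nbrs E x \<subseteq> {if t = 0 then hd c else b ! (t - 1), b ! Suc t}"
    using cwb_nbrs_branch[OF 2(1,2)] 2(3) by auto
  then have "card (nbrs E x) \<le> card {if t = 0 then hd c else b ! (t - 1), b ! Suc t}"
    by (intro card_mono) auto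
  also have "\<dots> \<le> 2"
    by (simp add: card_insert_if)
  finally show ?thesis
    by (simp add: degree_eq_card_nbrs[OF G])
qed

lemma cwb_degree_cycle_ge:
  assumes "x \<in> set c"
  shows "2 \<le> degree E x"
proof -
  have "nbrs (cycle_edges c) x \<subseteq> nbrs E x"
    unfolding cwb_edges nbrs_def by blast
  then show ?thesis
    using card_nbrs_cycle_edges[OF cwb_distinct(1) cwb_nonempty(1) assms]
      card_mono[OF simple_graph_finite_nbrs[OF G]] by (metis degree_eq_card_nbrs[OF G])
qed

lemma cwb_branch_nbrs:
  assumes "b \<in> set bs"
  shows "t < length b \<Longrightarrow> (if t = 0 then hd c else b ! (t - 1)) \<in> nbrs E (b ! t)"
    and "Suc t < length b \<Longrightarrow> b ! Suc t \<in> nbrs E (b ! t)"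
proof -
  have path: "b ! Suc t \<in> nbrs E (b ! t)" if "Suc t < length b" for t
    using that assms by (subst cwb_edges) (auto simp: nbrs_def branch_edges_def path_edges_def)
  then show "Suc t < length b \<Longrightarrow> b ! Suc t \<in> nbrs E (b ! t)" .
  have "hd c \<in> nbrs E (hd b)"
    using assms by (subst cwb_edges) (auto simp: nbrs_def branch_edges_def insert_commute)
  then show "(if t = 0 then hd c else b ! (t - 1)) \<in> nbrs E (b ! t)" if "t < length b"
    using that path[of "t - 1"] cwb_nonempty(3)[OF assms]
    by (cases "t = 0") (simp_all add: hd_conv_nth nbrs_commute[of "b ! (t - Suc 0)"])
qed

lemma cwb_degree_inner_ge:
  assumes "b \<in> set bs" "Suc t < length b"
  shows "2 \<le> degree E (b ! t)"
proof -
  let ?p = "if t = 0 then hd c else b ! (t - 1)"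
  have "?p \<noteq> b ! Suc t"
  proof (cases "t = 0")
    case True
    then show ?thesis
      using cwb_distinct(3)[OF assms(1)] cwb_nonempty(2) nth_mem[OF assms(2)] by auto
  next
    case False
    then show ?thesis
      using cwb_distinct(2)[OF assms(1)] assms(2) by (simp add: nth_eq_iff_index_eq)
  qed
  then have "card {?p, b ! Suc t} = 2"
    by simp
  moreover have "{?p, b ! Suc t} \<subseteq> nbrs E (b ! t)"
    using cwb_branch_nbrs[OF assms(1), of t] assms(2) by auto
  ultimately show ?thesis
    using card_mono[OF simple_graph_finite_nbrs[OF G]] by (metis degree_eq_card_nbrs[OF G])
qed

text \<open>Cycle vertices and inner branch vertices already have two neighbours. In the induction
  on leaves this locates where a removed leaf was attached: a vertex other than the root whose
  degree has fallen to at most 1 ends a branch.\<close>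

lemma cwb_degree_le_1:
  assumes "x \<in> V" "degree E x \<le> 1"
  obtains b where "b \<in> set bs" "x = last b"
  using assms(1)
proof (cases rule: cwb_vertex_cases)
  case 1
  then show ?thesis
    using cwb_degree_cycle_ge assms(2) by fastforce
next
  case (2 b t)
  then have "Suc t = length b"
    using cwb_degree_inner_ge[of b t] assms(2) by fastforce
  then have "x = last b"
    using 2 by (metis Suc_diff_1 diff_Suc_1 last_conv_nth length_0_conv nat.distinct(1))
  then show ?thesis
    using 2 that by blast
qed

text \<open>A leaf ends its branch, and a branch vertex adjacent to the root begins it, so the two
  together leave a branch of one vertex.\<close>

lemma cwb_leaf_nbrs: "x \<in> leaf_nbrs E (hd c) \<longleftrightarrow> [x] \<in> set bs"
proof
  assume x: "[x] \<in> set bs"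
  have "z = hd c" if "z \<in> nbrs E x" for z
    using cwb_nbrs_branch[OF x, of 0 z] that by simp
  moreover have "hd c \<in> nbrs E x"
    using cwb_branch_nbrs(1)[OF x, of 0] by simp
  ultimately have "nbrs E x = {hd c}"
    by blast
  then show "x \<in> leaf_nbrs E (hd c)"
    using nbrs_commute[of x E "hd c"] by (simp add: leaf_nbrs_def degree_eq_card_nbrs[OF G])
next
  assume "x \<in> leaf_nbrs E (hd c)"
  then have x: "hd c \<in> nbrs E x" "degree E x = 1"
    using nbrs_commute[of x E "hd c"] by (simp_all add: leaf_nbrs_def)
  then obtain b where b: "b \<in> set bs" "x = last b"
    using cwb_degree_le_1[of x] simple_graph_nbrs[OF G x(1)] by auto
  have len: "length b - 1 < length b" "x = b ! (length b - 1)"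
    using b cwb_nonempty(3)[OF b(1)] by (auto simp: last_conv_nth)
  have "hd c \<notin> set b"
    using cwb_distinct(3)[OF b(1)] cwb_nonempty(2) by auto
  then have "length b - 1 = 0"
    using cwb_nbrs_branch[OF b(1) len(1), of "hd c"] x(1) len nth_mem[of "length b - 1 - 1" b] nth_mem[of "Suc (length b - 1)" b] by force
  then have "b = [x]"
    using len by (cases b) auto
  then show "[x] \<in> set bs"
    using b by simp
qed

lemma cwb_card_leaf_nbrs:
  "card (leaf_nbrs E (hd c)) = length (filter (\<lambda>r. r = 1) (map length bs))"
proof -
  have "leaf_nbrs E (hd c) = hd ` {b \<in> set bs. length b = 1}"
  proof (intro equalityI subsetI)
    fix x assume "x \<in> leaf_nbrs E (hd c)"
    then show "x \<in> hd ` {b \<in> set bs. length b = 1}"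
      unfolding cwb_leaf_nbrs by (intro image_eqI[of _ _ "[x]"]) auto
  next
    fix x assume "x \<in> hd ` {b \<in> set bs. length b = 1}"
    then show "x \<in> leaf_nbrs E (hd c)"
      unfolding cwb_leaf_nbrs by (auto simp: length_Suc_conv)
  qed
  also have "card \<dots> = card {b \<in> set bs. length b = 1}"
    by (intro card_image inj_onI) (auto simp: length_Suc_conv)
  also have "\<dots> = length (filter (\<lambda>b. length b = 1) bs)"
    using cwb_distinct(5) by (simp add: distinct_length_filter Int_def conj_commute)
  finally show ?thesis
    by (simp add: filter_map o_def)
qed

end

text \<open>A longest path from \<open>v\<close> cannot be extended, so both neighbours of its last
  vertex lie on it. Inner vertices have spent their degree on their path neighbours; hence the
  neighbour other than the predecessor is \<open>v\<close>. The cycle so closed contains all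
  neighbours of its vertices and spans by connectedness.\<close>

lemma two_regular_connected_cycle:
  assumes G: "simple_graph V E" "connected_graph V E" and reg: "\<And>x. x \<in> V \<Longrightarrow> degree E x = 2"
    and v: "v \<in> V"
  shows "\<exists>c. 3 \<le> length c \<and> distinct c \<and> set c = V \<and> hd c = v \<and> E = cycle_edges c"
proof -
  define P where "P xs \<longleftrightarrow> xs \<noteq> [] \<and> hd xs = v \<and> distinct xs \<and> set xs \<subseteq> V \<and> path_edges xs \<subseteq> E" for xs
  have finV: "finite V"
    using G(1) by (simp add: simple_graph_def)
  have "P [v]"
    using v by (simp add: P_def path_edges_def)
  moreover have "length xs < Suc (card V)" if "P xs" for xs
    using that finV card_mono[of V "set xs"] by (simp add: P_def distinct_card)
  ultimately obtain xs where xs: "P xs" and max: "\<And>ys. P ys \<Longrightarrow> length ys \<le> length xs"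
    using ex_has_greatest_nat[of P "[v]" length "Suc (card V)"] by blast
  let ?k = "length xs"
  have P: "xs \<noteq> []" "hd xs = v" "distinct xs" "set xs \<subseteq> V" "path_edges xs \<subseteq> E"
    using xs by (auto simp: P_def)
  have deg: "card (nbrs E x) = 2" "finite (nbrs E x)" if "x \<in> set xs" for x
    using reg[of x] that P(4) simple_graph_finite_nbrs[OF G(1)]
    by (auto simp: degree_eq_card_nbrs[OF G(1)])
  have last_nbrs: "nbrs E (last xs) \<subseteq> set xs"
  proof
    fix z assume z: "z \<in> nbrs E (last xs)"
    show "z \<in> set xs"
    proof (rule ccontr)
      assume "z \<notin> set xs"
      then have "P (xs @ [z])"
        using P z simple_graph_nbrs[OF G(1) z] by (simp add: P_def path_edges_snoc nbrs_def)
      then show False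
        using max by fastforce
    qed
  qed
  have succ: "xs ! Suc i \<in> nbrs E (xs ! i)" "xs ! i \<in> nbrs E (xs ! Suc i)" if "Suc i < ?k" for i
  proof -
    have "{xs ! i, xs ! Suc i} \<in> E"
      using P(5) that unfolding path_edges_def by blast
    then show "xs ! Suc i \<in> nbrs E (xs ! i)" "xs ! i \<in> nbrs E (xs ! Suc i)"
      by (simp_all add: nbrs_def insert_commute)
  qed
  have inner: "nbrs E (xs ! i) = {xs ! (i - 1), xs ! Suc i}" if "0 < i" "Suc i < ?k" for i
  proof (rule card_seteq[symmetric])
    have "xs ! (i - 1) \<noteq> xs ! Suc i"
      using P(3) that by (simp add: nth_eq_iff_index_eq)
    then show "card (nbrs E (xs ! i)) \<le> card {xs ! (i - 1), xs ! Suc i}"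
      using deg(1)[of "xs ! i"] that by simp
    show "{xs ! (i - 1), xs ! Suc i} \<subseteq> nbrs E (xs ! i)"
      using succ(1)[of i] succ(2)[of "i - 1"] that by simp
  qed (use deg that in auto)
  have last: "last xs = xs ! (?k - 1)" "last xs \<in> set xs"
    using P(1) by (auto simp: last_conv_nth)
  have k: "3 \<le> ?k"
  proof -
    have "nbrs E (last xs) \<subseteq> set xs - {last xs}"
      using last_nbrs simple_graph_nbrs(3)[OF G(1)] by blast
    then have "2 \<le> card (set xs - {last xs})"
      using deg(1)[OF last(2)] card_mono[of "set xs - {last xs}" "nbrs E (last xs)"] by simp
    then show ?thesis
      using last(2) distinct_card[OF P(3)] by simp
  qed
  have "\<not> nbrs E (last xs) \<subseteq> {xs ! (?k - 2)}"
    using card_mono[of "{xs ! (?k - 2)}" "nbrs E (last xs)"] deg(1)[OF last(2)] by auto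
  then obtain j where j: "j < ?k" "xs ! j \<in> nbrs E (last xs)" "j \<noteq> ?k - 2"
    using last_nbrs by (fastforce simp: in_set_conv_nth)
  have "xs ! j \<noteq> last xs"
    using simple_graph_nbrs(3)[OF G(1) j(2)] by simp
  then have jk: "Suc j < ?k"
    using last(1) j by (cases "j = ?k - 1") auto
  have "j = 0"
  proof (rule ccontr)
    assume "j \<noteq> 0"
    then have "xs ! (?k - 1) \<in> {xs ! (j - 1), xs ! Suc j}"
      using inner[of j] jk j(2) nbrs_commute[of "xs ! j"] by (simp add: last(1))
    then have "?k - 1 = j - 1 \<or> ?k - 1 = Suc j"
      using P(3) jk by (auto simp: nth_eq_iff_index_eq)
    then show False
      using j(3) jk by linarith
  qed
  then have closing: "{xs ! (?k - 1), xs ! 0} \<in> E"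
    using j(2) last(1) by (simp add: nbrs_def)
  have cyc_sub: "cycle_edges xs \<subseteq> E"
  proof
    fix e assume "e \<in> cycle_edges xs"
    then obtain i where i: "i < ?k" "e = {xs ! i, xs ! (Suc i mod ?k)}"
      by (auto simp: cycle_edges_def)
    show "e \<in> E"
    proof (cases "Suc i = ?k")
      case True
      then have "i = ?k - 1"
        by simp
      then show ?thesis
        using closing i(2) True by simp
    next
      case False
      then show ?thesis
        using i succ(1)[of i] by (simp add: nbrs_def)
    qed
  qed
  have nb: "nbrs E x = nbrs (cycle_edges xs) x" if "x \<in> set xs" for x
    using card_nbrs_cycle_edges[OF P(3) k that] deg[OF that] cyc_sub
    by (intro card_seteq[symmetric]) (auto simp: nbrs_def)
  have "nbrs E x \<subseteq> set xs" if "x \<in> set xs" for x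
    unfolding nb[OF that] using cycle_edges_subset[of _ xs] by (auto simp: nbrs_def)
  then have V: "set xs = V"
    using connected_closed_subset[OF G(2) v, of "set xs"] P hd_in_set[OF P(1)] by auto
  have "E \<subseteq> cycle_edges xs"
  proof
    fix e assume e: "e \<in> E"
    then obtain x y where xy: "e = {x, y}" "x \<in> V"
      using simple_graph_edgeE[OF G(1)] by metis
    then have "y \<in> nbrs (cycle_edges xs) x"
      using nb[of x] e V by (auto simp: nbrs_def)
    then show "e \<in> cycle_edges xs"
      using xy by (simp add: nbrs_def)
  qed
  then show ?thesis
    using P k V cyc_sub by blast
qed

section \<open>Stripping leaves\<close>

lemma connected_graph_remove_leaf:
  assumes "connected_graph V E" "nbrs E u = {w}" "w \<in> V - {u}"
  shows "connected_graph (V - {u}) (E - {{u, w}})"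
proof -
  let ?E = "E - {{u, w}}"
  \<comment> \<open>A walk in the old graph may visit \<open>u\<close>, but only as a detour from
    \<open>w\<close> back to \<open>w\<close>; while it stands at \<open>u\<close>, the invariant
    records that \<open>w\<close> has been reached.\<close>
  have step: "(if y = u then (adj ?E)\<^sup>*\<^sup>* x w else (adj ?E)\<^sup>*\<^sup>* x y)"
    if "(adj E)\<^sup>*\<^sup>* x y" "x \<noteq> u" for x y
    using that(1)
  proof (induction rule: rtranclp_induct)
    case base
    then show ?case using that(2) by simp
  next
    case (step y z)
    have u_nbr: "z = w" if "{u, z} \<in> E" for z
      using assms(2) that by (auto simp: nbrs_def)
    consider "y = u" | "z = u" "y \<noteq> u" | "y \<noteq> u" "z \<noteq> u"
      by blast
    then show ?case
    proof cases
      case 1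
      then have "z = w"
        using step(2) u_nbr by (simp add: adj_def)
      then show ?thesis
        using step(3) 1 assms(3) by simp
    next
      case 2
      then have "y = w"
        using step(2) u_nbr by (simp add: adj_def insert_commute)
      then show ?thesis
        using step(3) 2 by simp
    next
      case 3
      then have "adj ?E y z"
        using step(2) by (auto simp: adj_def doubleton_eq_iff)
      then show ?thesis
        using step(3) 3 by simp
    qed
  qed
  show ?thesis
    unfolding connected_graph_def
  proof (intro conjI ballI)
    show "V - {u} \<noteq> {}"
      using assms(3) by blast
    fix x y assume "x \<in> V - {u}" "y \<in> V - {u}"
    then show "(adj ?E)\<^sup>*\<^sup>* x y"
      using assms(1) step[of x y] by (simp add: connected_graph_def)
  qed
qed

text \<open>A leaf \<open>u\<close> other than \<open>v\<close> is removed and put back after the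
  induction. If it hung on \<open>v\<close>, it becomes a new branch. Otherwise its neighbour had
  degree at most 2, is left with degree at most 1 and so ends a branch, which \<open>u\<close>
  prolongs. If no such leaf exists, every degree off \<open>v\<close> is 2, and the degree sum gives
  \<open>v\<close> degree 2 as well.\<close>

lemma cycle_with_branches_exists:
  assumes "simple_graph V E" "connected_graph V E" "card E = card V" "v \<in> V"
    and "\<And>w. w \<in> V - {v} \<Longrightarrow> degree E w \<le> 2"
  shows "\<exists>c bs. cycle_with_branches V E c bs \<and> hd c = v \<and> length bs + 2 = degree E v"
  using assms
proof (induction "card V" arbitrary: V E rule: less_induct)
  case less
  note G = less.prems(1-3) and v = \<open>v \<in> V\<close> and le2 = less.prems(5)
  have finV: "finite V"
    using G(1) by (simp add: simple_graph_def)
  have finE: "finite E"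
    by (rule simple_graph_finite_edges[OF G(1)])
  show ?case
  proof (cases "\<exists>u\<in>V - {v}. degree E u = 1")
    case True
    then obtain u where u: "u \<in> V" "u \<noteq> v" "degree E u = 1"
      by blast
    then obtain w where w: "nbrs E u = {w}"
      using degree_eq_card_nbrs[OF G(1)] by (metis card_1_singletonE)
    then have wV: "w \<in> V - {u}" and uw: "{u, w} \<in> E"
      using simple_graph_nbrs[OF G(1), of w u] by (auto simp: nbrs_def)
    define E' where "E' = E - {{u, w}}"
    define V' where "V' = V - {u}"
    have E: "E = insert {u, w} E'"
      using uw by (auto simp: E'_def)
    have G': "simple_graph V' E'"
      unfolding simple_graph_def
    proof (intro conjI ballI)
      fix e assume "e \<in> E'"
      then have e: "e \<in> E" "e \<noteq> {u, w}"
        by (auto simp: E'_def)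
      then obtain x y where xy: "x \<in> V" "y \<in> V" "x \<noteq> y" "e = {x, y}"
        using simple_graph_edgeE[OF G(1)] by metis
      have "u \<notin> e"
      proof
        assume "u \<in> e"
        then obtain z where "e = {u, z}"
          using simple_graph_edge_at[OF G(1) e(1)] by metis
        then show False
          using e w by (auto simp: nbrs_def)
      qed
      then show "\<exists>x y. x \<in> V' \<and> y \<in> V' \<and> x \<noteq> y \<and> e = {x, y}"
        using xy by (auto simp: V'_def)
    qed (use finV in \<open>auto simp: V'_def\<close>)
    have deg': "degree E' x \<le> degree E x" for x
      unfolding degree_def using finE by (intro card_mono) (auto simp: E'_def)
    have "{e \<in> E. w \<in> e} = insert {u, w} {e \<in> E'. w \<in> e}"
      using uw by (auto simp: E'_def)
    then have degw: "degree E w = degree E' w + 1"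
      using finE by (simp add: degree_def E'_def)
    have degv: "degree E' v = degree E v" if "w \<noteq> v"
      using that u(2) unfolding degree_def E'_def
      by (intro arg_cong[where f = card]) auto
    have "card V' < card V" "card E' = card V'"
      using u finV finE uw G(3) card_gt_0_iff[of V] by (auto simp: V'_def E'_def)
    moreover have "connected_graph V' E'"
      unfolding V'_def E'_def by (rule connected_graph_remove_leaf[OF G(2) w wV])
    moreover have "degree E' x \<le> 2" if "x \<in> V' - {v}" for x
      using le2[of x] deg'[of x] that by (simp add: V'_def)
    ultimately obtain c bs where cb: "cycle_with_branches V' E' c bs" "hd c = v" "length bs + 2 = degree E' v"
      using less.hyps[of V' E'] G' u(1,2) v by (auto simp: V'_def)
    have u_new: "u \<notin> set c" "u \<notin> set (concat bs)"
      using cb(1) by (auto simp: cycle_with_branches_def V'_def)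
    have V: "V = insert u V'"
      using u by (auto simp: V'_def)
    show ?thesis
    proof (cases "w = v")
      case True
      have "cycle_with_branches V E c ([u] # bs)"
        using cb(1,2) u_new True unfolding cycle_with_branches_def E V
        by (auto simp: branch_edges_def path_edges_def insert_commute)
      moreover have "length ([u] # bs) + 2 = degree E v"
        using cb(3) degw True by simp
      ultimately show ?thesis
        using cb(2) by blast
    next
      case False
      then have "degree E' w \<le> 1" "w \<in> V'"
        using degw le2[of w] wV by (auto simp: V'_def)
      then obtain b where b: "b \<in> set bs" "w = last b"
        using cwb_degree_le_1[OF G' cb(1)] by metis
      have bne: "b \<noteq> []"
        using b(1) cb(1) by (auto simp: cycle_with_branches_def)
      obtain ys zs where bs: "bs = ys @ b # zs"
        using b(1) by (metis split_list)
      have "branch_edges v (b @ [u]) = insert {u, w} (branch_edges v b)"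
        using bne b(2) by (auto simp: branch_edges_def path_edges_snoc insert_commute)
      then have "cycle_with_branches V E c (ys @ (b @ [u]) # zs)"
        using cb(1,2) u_new unfolding cycle_with_branches_def E V bs by auto
      then show ?thesis
        using cb(2,3) degv[OF False] by (intro exI[of _ c] exI[of _ "ys @ (b @ [u]) # zs"]) (simp add: bs)
    qed
  next
    case False
    have deg2: "degree E w = 2" if "w \<in> V - {v}" for w
      using le2[OF that] False that connected_degree_pos[OF G(1,2), of w v] v
      by (cases "degree E w = 1") force+
    have "degree E v + (\<Sum>w\<in>V - {v}. degree E w) = 2 * card V"
      using handshake[OF G(1)] G(3) sum.remove[OF finV v, of "degree E"] by simp
    moreover have "(\<Sum>w\<in>V - {v}. degree E w) = 2 * (card V - 1)"
      using deg2 finV v by simp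
    moreover have "0 < card V"
      using finV v by (auto simp: card_gt_0_iff)
    ultimately have degv: "degree E v = 2"
      by simp
    then have "degree E x = 2" if "x \<in> V" for x
      using deg2[of x] that by (cases "x = v") auto
    then obtain c where c: "3 \<le> length c" "distinct c" "set c = V" "hd c = v" "E = cycle_edges c"
      using two_regular_connected_cycle[OF G(1,2) _ v] by blast
    then have "cycle_with_branches V E c []"
      by (simp add: cycle_with_branches_def)
    then show ?thesis
      using c(4) degv by (intro exI[of _ c] exI[of _ "[]"]) simp
  qed
qed

section \<open>Isomorphism with the model graphs\<close>

text \<open>The blocks are the images of the intervals on which \<open>cyc_paths_E\<close> places
  its paths, so a numbering \<open>g\<close> of the vertices and a family of branches can be
  recovered from each other.\<close>

definition branch_blocks :: "(nat \<Rightarrow> 'a) \<Rightarrow> nat \<Rightarrow> nat list \<Rightarrow> 'a list list" where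
  "branch_blocks g k rs =
     map (\<lambda>j. map g [k + sum_list (take j rs) ..< k + sum_list (take j rs) + rs ! j]) [0..<length rs]"

lemma map_length_branch_blocks: "map length (branch_blocks g k rs) = rs"
  by (simp add: branch_blocks_def o_def map_nth)

lemma branch_blocks_snoc:
  "branch_blocks g k (rs @ [r]) = branch_blocks g k rs @ [map g [k + sum_list rs ..< k + sum_list rs + r]]"
  by (simp add: branch_blocks_def nth_append)

lemma concat_branch_blocks: "concat (branch_blocks g k rs) = map g [k..<k + sum_list rs]"
proof (induction rs rule: rev_induct)
  case Nil
  then show ?case by (simp add: branch_blocks_def)
next
  case (snoc r rs)
  have "[k..<k + sum_list rs] @ [k + sum_list rs ..< k + sum_list rs + r] = [k..<k + sum_list rs + r]"
    by (metis le_add1 upt_add_eq_append)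
  then show ?case
    using snoc by (simp add: branch_blocks_snoc add.assoc flip: map_append)
qed

lemma branch_blocks_nth:
  "branch_blocks (nth (c @ concat bs)) (length c) (map length bs) = bs"
proof (rule nth_equalityI)
  let ?s = "\<lambda>j. length c + sum_list (take j (map length bs))"
  show "length (branch_blocks (nth (c @ concat bs)) (length c) (map length bs)) = length bs"
    by (simp add: branch_blocks_def)
  fix j assume "j < length (branch_blocks (nth (c @ concat bs)) (length c) (map length bs))"
  then have j: "j < length bs"
    by (simp add: branch_blocks_def)
  have "concat bs = concat (take j bs) @ bs ! j @ concat (drop (Suc j) bs)"
    using id_take_nth_drop[OF j] by (metis concat.simps(2) concat_append)
  moreover have "?s j = length (c @ concat (take j bs))"
    by (simp add: length_concat take_map)
  ultimately have "(c @ concat bs) ! (?s j + t) = bs ! j ! t" if "t < length (bs ! j)" for t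
    using that by (metis append.assoc nth_append nth_append_length_plus)
  then have "map (nth (c @ concat bs)) [?s j ..< ?s j + length (bs ! j)] = bs ! j"
    by (intro nth_equalityI) auto
  then show "branch_blocks (nth (c @ concat bs)) (length c) (map length bs) ! j = bs ! j"
    using j by (simp add: branch_blocks_def)
qed

lemma sum_list_take_nth_le:
  fixes rs :: "nat list"
  assumes "j < length rs"
  shows "sum_list (take j rs) + rs ! j \<le> sum_list rs"
  using arg_cong[OF id_take_nth_drop[OF assms], of sum_list] by simp

text \<open>Positive entries matter: for an entry 0 the attaching edge would lead to the first
  vertex of a later path or out of the vertex set.\<close>

lemma cyc_paths_E_pair:
  assumes "3 \<le> k" "\<And>r. r \<in> set rs \<Longrightarrow> 1 \<le> r" "e \<in> cyc_paths_E k rs"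
  obtains x y where "x \<in> cyc_paths_V k rs" "y \<in> cyc_paths_V k rs" "x \<noteq> y" "e = {x, y}"
proof -
  consider i where "i < k" "e = {i, (i + 1) mod k}"
    | j where "j < length rs" "e = {0, k + sum_list (take j rs)}"
    | j t where "j < length rs" "t + 1 < rs ! j"
        "e = {k + sum_list (take j rs) + t, k + sum_list (take j rs) + t + 1}"
    using assms(3) unfolding cyc_paths_E_def by blast
  then show ?thesis
  proof cases
    case 1
    have "(i + 1) mod k < k" "i \<noteq> (i + 1) mod k"
      using 1 assms(1) by (auto simp: mod_Suc)
    then show ?thesis
      using 1 that[of i "(i + 1) mod k"] by (simp add: cyc_paths_V_def trans_less_add1)
  next
    case 2
    have "1 \<le> rs ! j"
      using assms(2) 2(1) by simp
    then show ?thesis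
      using 2 assms(1) that[of 0 "k + sum_list (take j rs)"] sum_list_take_nth_le[OF 2(1)]
      by (simp add: cyc_paths_V_def)
  next
    case 3
    then show ?thesis
      using that[of "k + sum_list (take j rs) + t" "k + sum_list (take j rs) + t + 1"]
        sum_list_take_nth_le[OF 3(1)]
      by (simp add: cyc_paths_V_def)
  qed
qed

lemma image_cyc_paths_E:
  assumes "3 \<le> k" "\<And>r. r \<in> set rs \<Longrightarrow> 1 \<le> r"
  shows "(`) g ` cyc_paths_E k rs
    = cycle_edges (map g [0..<k]) \<union> (\<Union>b\<in>set (branch_blocks g k rs). branch_edges (g 0) b)"
proof -
  let ?s = "\<lambda>j. k + sum_list (take j rs)"
  let ?b = "\<lambda>j. map g [?s j ..< ?s j + rs ! j]"
  have "(`) g ` {{i, (i + 1) mod k} | i. i < k} = cycle_edges (map g [0..<k])"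
  proof -
    have "(`) g ` {{i, (i + 1) mod k} | i. i < k} = {{g i, g (Suc i mod k)} | i. i < k}"
      by (auto simp: image_iff) (metis image_empty image_insert)
    also have "\<dots> = cycle_edges (map g [0..<k])"
      unfolding cycle_edges_def using assms(1) by (intro Collect_cong ex_cong1) auto
    finally show ?thesis .
  qed
  moreover have "branch_edges (g 0) (?b j) = insert {g 0, g (?s j)} {{g (?s j + t), g (?s j + t + 1)} | t. t + 1 < rs ! j}"
    if "j < length rs" for j
  proof -
    have "hd (?b j) = g (?s j)"
      using assms(2)[of "rs ! j"] that by (simp add: hd_map)
    moreover have "path_edges (?b j) = {{g (?s j + t), g (?s j + t + 1)} | t. t + 1 < rs ! j}"
      unfolding path_edges_def by (intro Collect_cong ex_cong1) auto
    ultimately show ?thesis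
      by (simp add: branch_edges_def)
  qed
  then have "(\<Union>b\<in>set (branch_blocks g k rs). branch_edges (g 0) b)
      = (\<Union>j<length rs. insert {g 0, g (?s j)} {{g (?s j + t), g (?s j + t + 1)} | t. t + 1 < rs ! j})"
    unfolding branch_blocks_def by (simp add: atLeast0LessThan)
  moreover have "(`) g ` ({{0, ?s j} | j. j < length rs}
        \<union> {{?s j + t, ?s j + t + 1} | j t. j < length rs \<and> t + 1 < rs ! j})
      = (\<Union>j<length rs. insert {g 0, g (?s j)} {{g (?s j + t), g (?s j + t + 1)} | t. t + 1 < rs ! j})"
    (is "?L = ?R")
  proof (intro equalityI subsetI)
    fix e assume "e \<in> ?L"
    then consider j where "j < length rs" "e = g ` {0, ?s j}"
      | j t where "j < length rs" "t + 1 < rs ! j" "e = g ` {?s j + t, ?s j + t + 1}"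
      by blast
    then show "e \<in> ?R"
      by cases auto
  next
    fix e assume "e \<in> ?R"
    then consider j where "j < length rs" "e = g ` {0, ?s j}"
      | j t where "j < length rs" "t + 1 < rs ! j" "e = g ` {?s j + t, ?s j + t + 1}"
      by auto
    then show "e \<in> ?L"
      by cases blast+
  qed
  ultimately show ?thesis
    unfolding cyc_paths_E_def image_Un Un_assoc by simp
qed

text \<open>The bijection is turned around to run from the model to the graph, since a vertex list
  is itself a map from numbers to vertices. Edges being pairs on both sides, preserving adjacency
  amounts to equality of edge sets.\<close>

lemma graph_iso_iff_image:
  assumes "simple_graph V E"
    and pair: "\<And>e. e \<in> E' \<Longrightarrow> \<exists>x y. x \<in> V' \<and> y \<in> V' \<and> e = {x, y}"
  shows "graph_iso V E V' E' \<longleftrightarrow> (\<exists>g. bij_betw g V' V \<and> E = (`) g ` E')"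
proof
  assume "graph_iso V E V' E'"
  then obtain f where f: "bij_betw f V V'"
    and iff: "\<And>u v. u \<in> V \<Longrightarrow> v \<in> V \<Longrightarrow> {u, v} \<in> E \<longleftrightarrow> {f u, f v} \<in> E'"
    unfolding graph_iso_def by blast
  let ?g = "inv_into V f"
  have g: "bij_betw ?g V' V"
    using f by (rule bij_betw_inv_into)
  have gf: "?g (f x) = x" if "x \<in> V" for x
    using f that by (simp add: bij_betw_inv_into_left)
  have fg: "f (?g x) = x" "?g x \<in> V" if "x \<in> V'" for x
    using f that bij_betwE[OF g] by (auto simp: bij_betw_inv_into_right)
  have "E = (`) ?g ` E'"
  proof (intro equalityI subsetI)
    fix e assume e: "e \<in> E"
    then obtain x y where xy: "x \<in> V" "y \<in> V" "e = {x, y}"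
      using simple_graph_edgeE[OF assms(1)] by metis
    then have "{f x, f y} \<in> E'" "e = ?g ` {f x, f y}"
      using iff e gf by auto
    then show "e \<in> (`) ?g ` E'"
      by blast
  next
    fix e assume "e \<in> (`) ?g ` E'"
    then obtain e' where e': "e' \<in> E'" "e = ?g ` e'"
      by blast
    then obtain x y where xy: "x \<in> V'" "y \<in> V'" "e' = {x, y}"
      using pair by blast
    then show "e \<in> E"
      using e' iff[of "?g x" "?g y"] fg by simp
  qed
  then show "\<exists>g. bij_betw g V' V \<and> E = (`) g ` E'"
    using g by blast
next
  assume "\<exists>g. bij_betw g V' V \<and> E = (`) g ` E'"
  then obtain g where g: "bij_betw g V' V" and E: "E = (`) g ` E'"
    by blast
  let ?f = "inv_into V' g"
  have gf: "g (?f x) = x" "?f x \<in> V'" if "x \<in> V" for x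
    using g that bij_betwE[OF bij_betw_inv_into[OF g]] by (auto simp: bij_betw_inv_into_right)
  have "{u, v} \<in> E \<longleftrightarrow> {?f u, ?f v} \<in> E'" if "u \<in> V" "v \<in> V" for u v
  proof -
    have "{u, v} = g ` {?f u, ?f v}"
      using gf that by simp
    moreover have "g ` {?f u, ?f v} = g ` e \<longleftrightarrow> {?f u, ?f v} = e" if "e \<in> E'" for e
      using pair[OF that] gf \<open>u \<in> V\<close> \<open>v \<in> V\<close>
      by (intro inj_on_image_eq_iff[OF bij_betw_imp_inj_on[OF g]]) auto
    ultimately show ?thesis
      unfolding E by (auto simp del: image_insert)
  qed
  then show "graph_iso V E V' E'"
    unfolding graph_iso_def using bij_betw_inv_into[OF g] by blast
qed

lemma graph_iso_cyc_paths_iff: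
  assumes "simple_graph V E" "3 \<le> k" "\<And>r. r \<in> set rs \<Longrightarrow> 1 \<le> r"
  shows "graph_iso V E (cyc_paths_V k rs) (cyc_paths_E k rs)
    \<longleftrightarrow> (\<exists>c bs. cycle_with_branches V E c bs \<and> length c = k \<and> map length bs = rs)"
proof -
  have "graph_iso V E (cyc_paths_V k rs) (cyc_paths_E k rs)
      \<longleftrightarrow> (\<exists>g. bij_betw g (cyc_paths_V k rs) V \<and> E = (`) g ` cyc_paths_E k rs)"
    by (rule graph_iso_iff_image[OF assms(1)]) (metis cyc_paths_E_pair[OF assms(2,3)])
  also have "\<dots> \<longleftrightarrow> (\<exists>c bs. cycle_with_branches V E c bs \<and> length c = k \<and> map length bs = rs)"
  proof
    assume "\<exists>g. bij_betw g (cyc_paths_V k rs) V \<and> E = (`) g ` cyc_paths_E k rs"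
    then obtain g where g: "bij_betw g {0..<k + sum_list rs} V" and E: "E = (`) g ` cyc_paths_E k rs"
      unfolding cyc_paths_V_def by blast
    let ?c = "map g [0..<k]" and ?bs = "branch_blocks g k rs"
    have L: "?c @ concat ?bs = map g [0..<k + sum_list rs]"
      unfolding concat_branch_blocks by (metis map_append upt_add_eq_append zero_le)
    have len: "length b \<ge> 1" if "b \<in> set ?bs" for b
      using assms(3) that map_length_branch_blocks[of g k rs] by (metis image_eqI list.set_map)
    have "cycle_with_branches V E ?c ?bs"
      unfolding cycle_with_branches_def L
    proof (intro conjI ballI)
      show "distinct (map g [0..<k + sum_list rs])" "set (map g [0..<k + sum_list rs]) = V"
        using g by (auto simp: distinct_map bij_betw_def)
      show "E = cycle_edges ?c \<union> (\<Union>b\<in>set ?bs. branch_edges (hd ?c) b)"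
        using image_cyc_paths_E[where g = g, OF assms(2,3)] assms(2) by (simp add: E hd_map)
      show "b \<noteq> []" if "b \<in> set ?bs" for b
        using len[OF that] by auto
    qed (use assms(2) in simp)
    then show "\<exists>c bs. cycle_with_branches V E c bs \<and> length c = k \<and> map length bs = rs"
      by (intro exI[of _ ?c] exI[of _ ?bs]) (simp add: map_length_branch_blocks)
  next
    assume "\<exists>c bs. cycle_with_branches V E c bs \<and> length c = k \<and> map length bs = rs"
    then obtain c bs where cb: "cycle_with_branches V E c bs" and k: "length c = k" and rs: "map length bs = rs"
      by blast
    let ?g = "nth (c @ concat bs)"
    have "length (c @ concat bs) = k + sum_list rs"
      by (simp add: length_concat k rs)
    then have bij: "bij_betw ?g (cyc_paths_V k rs) V"
      using bij_betw_nth[of "c @ concat bs"] cb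
      by (simp add: cyc_paths_V_def cycle_with_branches_def atLeast0LessThan)
    have "map ?g [0..<k] = c"
      using k by (intro nth_equalityI) (auto simp: nth_append)
    moreover have "?g 0 = hd c"
      using k assms(2) by (cases c) auto
    moreover have "branch_blocks ?g k rs = bs"
      using branch_blocks_nth[of c bs] k rs by simp
    ultimately have "E = (`) ?g ` cyc_paths_E k rs"
      using image_cyc_paths_E[where g = ?g, OF assms(2,3)] cb by (simp add: cycle_with_branches_def)
    then show "\<exists>g. bij_betw g (cyc_paths_V k rs) V \<and> E = (`) g ` cyc_paths_E k rs"
      using bij by blast
  qed
  finally show ?thesis .
qed

section \<open>Counting branch lengths\<close>

lemma cycle_with_branches_card:
  assumes "cycle_with_branches V E c bs"
  shows "card V = length c + sum_list (map length bs)"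
  using assms distinct_card[of "c @ concat bs"] by (simp add: cycle_with_branches_def length_concat)

text \<open>Only the set of branches determines the graph. This permits sorting them by length, so
  that the lengths can match the list \<open>U_rs\<close>, which puts the ones first.\<close>

lemma cycle_with_branches_perm:
  assumes "cycle_with_branches V E c bs" "set bs' = set bs" "distinct bs'"
  shows "cycle_with_branches V E c bs'"
proof -
  have "removeAll [] bs = bs" "removeAll [] bs' = bs'"
    using assms by (auto intro!: removeAll_id simp: cycle_with_branches_def)
  then show ?thesis
    using assms unfolding cycle_with_branches_def by (auto simp: distinct_concat_iff)
qed

text \<open>Each entry 1 is topped up to 2 by the second summand, and every other entry is at least
  2.\<close>

lemma sum_list_ge_twice_length:
  fixes rs :: "nat list"
  assumes "\<And>r. r \<in> set rs \<Longrightarrow> 1 \<le> r"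
  shows "2 * length rs \<le> sum_list rs + length (filter (\<lambda>r. r = 1) rs)"
  using assms
proof (induction rs)
  case (Cons a rs)
  then have "2 * length rs \<le> sum_list rs + length (filter (\<lambda>r. r = 1) rs)" "1 \<le> a"
    by auto
  then show ?case
    by auto
qed simp

text \<open>Equality in the preceding bound must hold entry by entry, which leaves only ones and
  twos.\<close>

lemma sum_list_eq_twice_length:
  fixes rs :: "nat list"
  assumes "\<And>r. r \<in> set rs \<Longrightarrow> 1 \<le> r"
    and "sum_list rs + length (filter (\<lambda>r. r = 1) rs) = 2 * length rs" "r \<in> set rs"
  shows "r \<le> 2"
  using assms
proof (induction rs)
  case (Cons a rs)
  have "2 * length rs \<le> sum_list rs + length (filter (\<lambda>r. r = 1) rs)"
    by (rule sum_list_ge_twice_length) (use Cons.prems(1) in simp)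
  moreover have "1 \<le> a"
    using Cons.prems(1) by simp
  ultimately have "a \<le> 2" "sum_list rs + length (filter (\<lambda>r. r = 1) rs) = 2 * length rs"
    using Cons.prems(2) by (auto split: if_splits)
  then show ?case
    using Cons.IH Cons.prems(1,3) by auto
qed simp

lemma sorted_ones_twos:
  fixes rs :: "nat list"
  assumes "sorted rs" "\<And>r. r \<in> set rs \<Longrightarrow> 1 \<le> r \<and> r \<le> 2" "length (filter (\<lambda>r. r = 1) rs) = p"
  shows "rs = replicate p 1 @ replicate (length rs - p) 2"
  using assms
proof (induction rs arbitrary: p)
  case (Cons a rs)
  show ?case
  proof (cases "a = 1")
    case True
    then show ?thesis
      using Cons.IH[of "p - 1"] Cons.prems by (cases p) auto
  next
    case False
    have "1 \<le> a" "a \<le> 2"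
      using Cons.prems(2)[of a] by auto
    then have two: "\<forall>r\<in>set (a # rs). r = 2"
      using Cons.prems(1,2) False by fastforce
    then have "a # rs = replicate (length (a # rs)) 2"
      by (metis replicate_length_same)
    moreover have "filter (\<lambda>r. r = 1) (a # rs) = []"
      using two by (auto simp: filter_empty_conv)
    ultimately show ?thesis
      using Cons.prems(3) by (metis append_Nil diff_zero list.size(3) replicate_0)
  qed
qed simp

lemma leaf_loss_pos: "a < 0 \<Longrightarrow> 3 \<le> D \<Longrightarrow> 0 < leaf_loss a D"
  using powr_neg_drop_strict[of a 3 "real D + 1"] by (simp add: leaf_loss_def add_ac)

lemma leaf_loss_2: "leaf_loss a 2 = 0"
  by (simp add: leaf_loss_def)

section \<open>The extremal theorem\<close>

theorem theorem2:
  fixes V :: "'a set" and E :: "'a set set" and n \<Delta> :: nat and \<alpha> :: real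
  assumes "n \<ge> 3" and "2 \<le> \<Delta>" and "\<Delta> \<le> n - 1"
    and "-1 \<le> \<alpha>" and "\<alpha> < 0"
    and "unicyclic V E" and "card V = n" and "max_degree V E = \<Delta>"
  shows "(n + 2 \<le> 2 * \<Delta> \<longrightarrow>
            chi \<alpha> E \<le> (real n - \<Delta> - 1) * 3 powr \<alpha> + (real n - \<Delta> + 1) * (real \<Delta> + 2) powr \<alpha>
                       + (2 * real \<Delta> - n - 1) * (real \<Delta> + 1) powr \<alpha> + 4 powr \<alpha>
          \<and> (chi \<alpha> E = (real n - \<Delta> - 1) * 3 powr \<alpha> + (real n - \<Delta> + 1) * (real \<Delta> + 2) powr \<alpha>
                       + (2 * real \<Delta> - n - 1) * (real \<Delta> + 1) powr \<alpha> + 4 powr \<alpha>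
             \<longleftrightarrow> graph_iso V E (U_V n \<Delta>) (U_E n \<Delta>)))
       \<and> (2 * \<Delta> \<le> n + 1 \<longrightarrow>
            chi \<alpha> E \<le> (real \<Delta> - 2) * 3 powr \<alpha> + real \<Delta> * (real \<Delta> + 2) powr \<alpha>
                       + (real n - 2 * \<Delta> + 2) * 4 powr \<alpha>
          \<and> (chi \<alpha> E = (real \<Delta> - 2) * 3 powr \<alpha> + real \<Delta> * (real \<Delta> + 2) powr \<alpha>
                       + (real n - 2 * \<Delta> + 2) * 4 powr \<alpha>
             \<longleftrightarrow> (\<exists>k rs. k \<ge> 3 \<and> length rs = \<Delta> - 2 \<and> (\<forall>r\<in>set rs. r \<ge> 2)
                    \<and> graph_iso V E (cyc_paths_V k rs) (cyc_paths_E k rs))))"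
proof -
  have G: "simple_graph V E" "connected_graph V E" "card E = card V"
    using assms(6) by (auto simp: unicyclic_def)
  have finV: "finite V" and V_ne: "V \<noteq> {}"
    using G by (auto simp: simple_graph_def connected_graph_def)
  have "\<Delta> \<in> degree E ` V"
    unfolding assms(8)[symmetric] max_degree_def using finV V_ne by (intro Max_in) auto
  then obtain v where v: "v \<in> V" "degree E v = \<Delta>"
    by blast
  have deg_le: "degree E w \<le> \<Delta>" if "w \<in> V" for w
    unfolding assms(8)[symmetric] max_degree_def using finV that by simp
  define T where "T = (real \<Delta> - 2) * 3 powr \<alpha> + real \<Delta> * (real \<Delta> + 2) powr \<alpha>
      + (real n - 2 * \<Delta> + 2) * 4 powr \<alpha>"
  define p where "p = card (leaf_nbrs E v)"
  define L where "L = leaf_loss \<alpha> \<Delta>"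
  have T: "T - real p * L = real \<Delta> * (real \<Delta> + 2) powr \<alpha> + (real n - real \<Delta>) * 4 powr \<alpha>
      + (real \<Delta> - 2) * (3 powr \<alpha> - 4 powr \<alpha>) - real p * L"
    by (simp add: T_def algebra_simps)
  have "2 \<le> degree E v"
    using v(2) assms(2) by simp
  note accounting = chi_accounting[OF G v(1) this assms(4,5), unfolded v(2) assms(7), folded p_def L_def, folded T]
  have chi_le: "chi \<alpha> E \<le> T - real p * L"
    and chi_eq: "chi \<alpha> E = T - real p * L \<longleftrightarrow> (\<forall>w\<in>V - {v}. degree E w \<le> 2)"
    by (fact accounting)+
  have L_nn: "0 \<le> L"
    using leaf_loss_pos[OF assms(5), of \<Delta>] leaf_loss_2[of \<alpha>] assms(2)
    by (cases "\<Delta> = 2") (auto simp: L_def)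
  have L_pos: "0 < L" if "3 \<le> \<Delta>"
    using leaf_loss_pos[OF assms(5) that] by (simp add: L_def)
  have shape: "\<exists>c bs. cycle_with_branches V E c bs \<and> length bs = \<Delta> - 2 \<and> sorted (map length bs)
      \<and> length (filter (\<lambda>r. r = 1) (map length bs)) = p"
    if small: "\<forall>w\<in>V - {v}. degree E w \<le> 2"
  proof -
    obtain c bs where cb: "cycle_with_branches V E c bs" "hd c = v" "length bs + 2 = \<Delta>"
      using cycle_with_branches_exists[OF G v(1)] small v(2) by blast
    let ?bs = "sort_key length bs"
    have "cycle_with_branches V E c ?bs"
      using cwb_distinct(5)[OF G(1) cb(1)] by (intro cycle_with_branches_perm[OF cb(1)]) auto
    then show ?thesis
      using cwb_card_leaf_nbrs[OF G(1), of c ?bs] cb(2,3)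
      by (intro exI[of _ c] exI[of _ ?bs]) (auto simp: p_def)
  qed
  \<comment> \<open>For \<open>\<Delta> \<ge> 3\<close> only the root can have degree above 2, so
    the root is \<open>v\<close> and the branches of length 1 are its leaves. For
    \<open>\<Delta> = 2\<close> the root may be another vertex, and the degree bound is immediate
    from the maximum degree.\<close>
  have shape_conv: "(\<forall>w\<in>V - {v}. degree E w \<le> 2)
      \<and> (3 \<le> \<Delta> \<longrightarrow> p = length (filter (\<lambda>r. r = 1) (map length bs)))"
    if cb: "cycle_with_branches V E c bs" for c bs
  proof (cases "3 \<le> \<Delta>")
    case True
    then have "hd c = v"
      using cwb_degree_le[OF G(1) cb v(1)] v(2) by force
    then show ?thesis
      using cwb_degree_le[OF G(1) cb] cwb_card_leaf_nbrs[OF G(1) cb] by (auto simp: p_def)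
  next
    case False
    then show ?thesis
      using deg_le assms(2) by force
  qed
  have long_branches: "chi \<alpha> E \<le> T \<and> (chi \<alpha> E = T \<longleftrightarrow> (\<exists>k rs. k \<ge> 3 \<and> length rs = \<Delta> - 2
      \<and> (\<forall>r\<in>set rs. r \<ge> 2) \<and> graph_iso V E (cyc_paths_V k rs) (cyc_paths_E k rs)))"
  proof (intro conjI iffI)
    show "chi \<alpha> E \<le> T"
      using chi_le L_nn by (smt (verit) mult_nonneg_nonneg of_nat_0_le_iff)
  next
    assume eq: "chi \<alpha> E = T"
    have "0 \<le> real p * L"
      using L_nn by simp
    then have pL: "real p * L = 0" and small: "\<forall>w\<in>V - {v}. degree E w \<le> 2"
      using chi_le chi_eq eq by auto
    obtain c bs where cb: "cycle_with_branches V E c bs" "length bs = \<Delta> - 2"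
      "length (filter (\<lambda>r. r = 1) (map length bs)) = p"
      using shape[OF small] by blast
    \<comment> \<open>For \<open>\<Delta> = 2\<close> the loss \<open>L\<close> is zero and
      \<open>pL\<close> says nothing about \<open>p\<close>; there are then no branches at all,
      hence none of length 1.\<close>
    have "p = 0"
    proof (cases "3 \<le> \<Delta>")
      case True
      then show ?thesis using pL L_pos by simp
    next
      case False
      then show ?thesis using cb(2,3) by simp
    qed
    then have "length b \<noteq> 1" if "b \<in> set bs" for b
      using cb(3) that by (auto simp: filter_empty_conv)
    moreover have "length b \<noteq> 0" if "b \<in> set bs" for b
      using cwb_nonempty(3)[OF G(1) cb(1) that] by simp
    ultimately have two: "2 \<le> r" if "r \<in> set (map length bs)" for r
      using that by (force simp: less_2_cases_iff not_less[symmetric])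
    have k: "3 \<le> length c"
      by (rule cwb_nonempty(1)[OF G(1) cb(1)])
    have "graph_iso V E (cyc_paths_V (length c) (map length bs)) (cyc_paths_E (length c) (map length bs))"
      using cb(1) two by (subst graph_iso_cyc_paths_iff[OF G(1) k]) fastforce+
    then show "\<exists>k rs. k \<ge> 3 \<and> length rs = \<Delta> - 2 \<and> (\<forall>r\<in>set rs. r \<ge> 2)
        \<and> graph_iso V E (cyc_paths_V k rs) (cyc_paths_E k rs)"
      using k two cb(2) by (intro exI[of _ "length c"] exI[of _ "map length bs"]) simp
  next
    assume "\<exists>k rs. k \<ge> 3 \<and> length rs = \<Delta> - 2 \<and> (\<forall>r\<in>set rs. r \<ge> 2)
        \<and> graph_iso V E (cyc_paths_V k rs) (cyc_paths_E k rs)"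
    then obtain k rs where krs: "k \<ge> 3" "length rs = \<Delta> - 2" "\<forall>r\<in>set rs. r \<ge> 2"
      "graph_iso V E (cyc_paths_V k rs) (cyc_paths_E k rs)"
      by blast
    have "1 \<le> r" if "r \<in> set rs" for r
      using krs(3) that by fastforce
    then obtain c bs where cb: "cycle_with_branches V E c bs" "map length bs = rs"
      using krs(4) graph_iso_cyc_paths_iff[OF G(1) krs(1)] by blast
    have "filter (\<lambda>r. r = 1) rs = []"
      using krs(3) by (force simp: filter_empty_conv)
    then have "p = 0" if "3 \<le> \<Delta>"
      using shape_conv[OF cb(1)] cb(2) that by simp
    moreover have "L = 0" if "\<not> 3 \<le> \<Delta>"
    proof -
      have "\<Delta> = 2" using that assms(2) by simp
      then show ?thesis by (simp add: L_def leaf_loss_2)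
    qed
    ultimately show "chi \<alpha> E = T"
      using shape_conv[OF cb(1)] chi_eq by (cases "3 \<le> \<Delta>") auto
  qed
  define B where "B = (real n - \<Delta> - 1) * 3 powr \<alpha> + (real n - \<Delta> + 1) * (real \<Delta> + 2) powr \<alpha>
      + (2 * real \<Delta> - n - 1) * (real \<Delta> + 1) powr \<alpha> + 4 powr \<alpha>"
  have short_branches: "chi \<alpha> E \<le> B \<and> (chi \<alpha> E = B \<longleftrightarrow> graph_iso V E (U_V n \<Delta>) (U_E n \<Delta>))"
    if n: "n + 2 \<le> 2 * \<Delta>"
  proof -
    \<comment> \<open>The number of pendant vertices in the model. By
      \<open>n + 2 \<le> 2 * \<Delta>\<close> the natural subtraction does not truncate.\<close>
    define q where "q = 2 * \<Delta> - n - 1"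
    have D3: "3 \<le> \<Delta>"
      using n assms(1) by linarith
    have q: "real q = 2 * real \<Delta> - real n - 1" "q + (n - \<Delta> - 1) = \<Delta> - 2"
      using n assms(3) D3 by (auto simp: q_def of_nat_diff)
    have pq: "q \<le> p"
      using card_leaf_nbrs_ge[OF G v(1)] v(2) assms(7) by (simp add: p_def q_def)
    have B: "B = T - real q * L"
      by (simp add: B_def T_def L_def leaf_loss_def q(1) algebra_simps)
    have less: "T - real p * L \<le> B" "T - real p * L = B \<longleftrightarrow> p = q"
      using L_pos[OF D3] pq unfolding B by auto
    have U: "set (U_rs n \<Delta>) \<subseteq> {1, 2}" "length (filter (\<lambda>r. r = 1) (U_rs n \<Delta>)) = q"
      by (auto simp: U_rs_def q_def)
    have iso: "graph_iso V E (U_V n \<Delta>) (U_E n \<Delta>)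
        \<longleftrightarrow> (\<exists>c bs. cycle_with_branches V E c bs \<and> length c = 3 \<and> map length bs = U_rs n \<Delta>)"
      unfolding U_V_def U_E_def using U(1) by (intro graph_iso_cyc_paths_iff[OF G(1)]) auto
    show ?thesis
      unfolding iso
    proof (intro conjI iffI)
      show "chi \<alpha> E \<le> B"
        using chi_le less(1) by linarith
    next
      assume "chi \<alpha> E = B"
      then have "chi \<alpha> E = T - real p * L" "p = q"
        using chi_le less by auto
      then obtain c bs where cb: "cycle_with_branches V E c bs" "length bs = \<Delta> - 2"
        "sorted (map length bs)" "length (filter (\<lambda>r. r = 1) (map length bs)) = q"
        using shape chi_eq by blast
      have ge1: "1 \<le> r" if "r \<in> set (map length bs)" for r
        using that cwb_nonempty(3)[OF G(1) cb(1)] by (auto simp: Suc_le_eq)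
      \<comment> \<open>Why a triangle: the branches hold \<open>n - length c\<close> vertices, and
        adding \<open>q\<close> gives \<open>2 * \<Delta> - 1 - length c\<close>. As this is at
        least \<open>2 * (\<Delta> - 2)\<close>, the cycle has at most three vertices, and with
        exactly three the branch count is tight.\<close>
      have "n = length c + sum_list (map length bs)"
        using cycle_with_branches_card[OF cb(1)] assms(7) by simp
      moreover have "3 \<le> length c"
        by (rule cwb_nonempty(1)[OF G(1) cb(1)])
      moreover have "2 * (\<Delta> - 2) \<le> sum_list (map length bs) + q"
        using sum_list_ge_twice_length[of "map length bs", OF ge1] unfolding cb(4) length_map cb(2) .
      ultimately have c3: "length c = 3" and "sum_list (map length bs) + q = 2 * (\<Delta> - 2)"
        using n D3 by (auto simp: q_def)
      then have tight: "sum_list (map length bs) + length (filter (\<lambda>r. r = 1) (map length bs))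
          = 2 * length (map length bs)"
        unfolding cb(4) length_map cb(2) by simp
      have "r \<le> 2" if "r \<in> set (map length bs)" for r
        by (rule sum_list_eq_twice_length[OF ge1 tight that])
      then have "map length bs = replicate q 1 @ replicate (length (map length bs) - q) 2"
        using ge1 by (intro sorted_ones_twos[OF cb(3) _ cb(4)]) auto
      then have "map length bs = U_rs n \<Delta>"
        using q(2) cb(2) unfolding U_rs_def q_def[symmetric] length_map
        by (metis add_diff_cancel_left')
      then show "\<exists>c bs. cycle_with_branches V E c bs \<and> length c = 3 \<and> map length bs = U_rs n \<Delta>"
        using cb(1) c3 by blast
    next
      assume "\<exists>c bs. cycle_with_branches V E c bs \<and> length c = 3 \<and> map length bs = U_rs n \<Delta>"
      then obtain c bs where cb: "cycle_with_branches V E c bs" "map length bs = U_rs n \<Delta>"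
        by blast
      then have "p = q"
        using shape_conv[OF cb(1)] D3 U(2) by simp
      then show "chi \<alpha> E = B"
        using shape_conv[OF cb(1)] chi_eq less(2) by simp
    qed
  qed
  show ?thesis
    using long_branches short_branches unfolding T_def B_def by blast
qed

end
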